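(* Let $N\in\mathbb{Z}_{>0}$, $A_k\in\mathbb{R}^{n\times n}$, $B_k\in\mathbb{R}^{n\times m}$ for $k=0,\dots,N-1$, and let $\bar\Sigma_0,\bar\Sigma_N\in\mathbb{R}^{n\times n}$ be symmetric positive definite. Assume: (a) $A_k$ is invertible for every $k\in\{0,\dots,N-1\}$; (b) there exists $k_{\rm r}\in\{1,\dots,N\}$ such that $G_{\rm r}(k,0)$ is invertible for every $k\in\{k_{\rm r},\dots,N\}$ and $G_{\rm r}(N,k)$ is invertible for every $k\in\{0,\dots,k_{\rm r}-1\}$; (c) with $$S_0:=G_{\rm c}(N,0)^{-1/2}\bar\Sigma_0G_{\rm c}(N,0)^{-1/2},\qquad S_N:=G_{\rm c}(N,0)^{-1/2}\Phi(0,N)\bar\Sigma_N\Phi(0,N)^\top G_{\rm c}(N,0)^{-1/2},$$ the two matrices $$\mathcal F(S_0,S_N):=S_0+\tfrac12I-\bigl(S_0^{1/2}S_NS_0^{1/2}+\tfrac14I\bigr)^{1/2},\qquad \mathcal B(S_0,S_N):=-S_0+\tfrac12I+\bigl(S_0^{1/2}S_NS_0^{1/2}+\tfrac14I\bigr)^{1/2}$$ are invertible. Let $\{Q_{-,k}\}_{k=0}^N$ be the solution of $$Q_{-,k+1}=A_kQ_{-,k}A_k^\top-B_kB_k^\top,\qquad Q_{-,0}=G_{\rm c}(N,0)^{1/2}S_0^{1/2}\,\mathcal F(S_0,S_N)^{-1}S_0^{1/2}G_{\rm c}(N,0)^{1/2}.$$ Consider the process $\{x_k^*\}_{k=0}^N$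 (the optimal state process of the MaxEnt optimal density control problem with $\varepsilon=1$) given by $x_0^*\sim\mathcal N(0,\bar\Sigma_0)$ and $$x_{k+1}^*=A_{Q,k}x_k^*+B_{Q,k}w_k,\qquad w_k\sim\mathcal N(0,I),$$ with $\{w_k\}$ an independent sequence independent of $x_0^*$, where $$A_{Q,k}:=A_k-B_k(I+B_k^\top Q_{-,k+1}^{-1}B_k)^{-1}B_k^\top Q_{-,k+1}^{-1}A_k,\qquad B_{Q,k}:=B_k(I+B_k^\top Q_{-,k+1}^{-1}B_k)^{-1/2}.$$ Then the probability distribution $\mathbb P^*_{0:N}$ of $\{x_k^*\}_{k=0}^N$ on $(\mathbb{R}^n)^{N+1}$ is the unique optimal solution of the Schrödinger bridge problem (defined in the context).
   Context: Notation. For invertible $A_k$, the state-transition matrix is $\Phi(k,l)=A_{k-1}A_{k-2}\cdots A_l$ if $k>l$, $\Phi(k,k)=I$, and $\Phi(k,l)=A_k^{-1}A_{k+1}^{-1}\cdots A_{l-1}^{-1}$ if $k<l$. For $k_0<k_1$, the reachability and controllability Gramians are $$G_{\rm r}(k_1,k_0)=\sum_{k=k_0}^{k_1-1}\Phi(k_1,k+1)B_kB_k^\top\Phi(k_1,k+1)^\top,\qquad G_{\rm c}(k_1,k_0)=\sum_{k=k_0}^{k_1-1}\Phi(k_0,k+1)B_kB_k^\top\Phi(k_0,k+1)^\top .$$ They satisfy $G_{\rm c}(k_1,k_0)=\Phi(k_0,k_1)G_{\rm r}(k_1,k_0)\Phi(k_0,k_1)^\top$. For a symmetric positive (semi)definite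 matrix $M$, $M^{1/2}$ is its unique positive (semi)definite square root. $\mathcal N(\mu,\Sigma)$ is the Gaussian distribution with mean $\mu$ and covariance $\Sigma$. MaxEnt optimal density control problem with $\varepsilon=1$. A policy is a sequence $\pi=\{\pi_k\}_{k=0}^{N-1}$, where $\pi_k(\cdot|x)$ is the conditional probability density on $\mathbb{R}^m$ of the input $u_k$ given $x_k=x$; with ${\rm H}(\pi_k(\cdot|x))=-\int\pi_k(u|x)\log\pi_k(u|x)\,du$, one minimizes $\mathbb E[\sum_{k=0}^{N-1}(\tfrac12\|u_k\|^2-{\rm H}(\pi_k(\cdot|x_k)))]$ over $\pi$ subject to $x_{k+1}=A_kx_k+B_ku_k$, $u_k\sim\pi_k(\cdot|x)$ given $x_k=x$, $x_0\sim\mathcal N(0,\bar\Sigma_0)$, $x_N\sim\mathcal N(0,\bar\Sigma_N)$. Schrödinger bridge problem. Let $\{\widetilde x_k\}_{k=0}^N$ solve $\widetilde x_{k+1}=A_k\widetilde x_k+B_kw_k$, with $w_k\sim\mathcal N(0,I)$ an independent sequence and independent initial state $\widetilde x_0\sim\mathcal N(0,\bar\Sigma_0)$, and let $\widetilde{\mathbb P}_{0:N}$ be its distribution on $(\mathbb{R}^n)^{N+1}$. The problem is to minimize the Kullback–Leibler divergence $D_{\rm KL}(\widehat{\mathbb P}_{0:N}\,\|\,\widetilde{\mathbb P}_{0:N})$ over all probability distributions $\widehat{\mathbb P}_{0:N}$ on $(\mathbb{R}^n)^{N+1}$ whose marginals at $k=0$ and $k=N$ are $\mathcal N(0,\bar\Sigma_0)$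 and $\mathcal N(0,\bar\Sigma_N)$, respectively. *)

theory Defs
  imports "HOL-Probability.Probability"
begin

definition pos_semidef :: "real^'n^'n \<Rightarrow> bool" where
  "pos_semidef M \<longleftrightarrow> transpose M = M \<and> (\<forall>x. 0 \<le> x \<bullet> (M *v x))"

definition pos_def :: "real^'n^'n \<Rightarrow> bool" where
  "pos_def M \<longleftrightarrow> transpose M = M \<and> (\<forall>x. x \<noteq> 0 \<longrightarrow> 0 < x \<bullet> (M *v x))"

(* Meaningful only for positive semidefinite M. *)
definition psd_sqrt :: "real^'n^'n \<Rightarrow> real^'n^'n" where
  "psd_sqrt M = (THE R. pos_semidef R \<and> R ** R = M)"

(* M^(-1/2), for positive definite M *)
definition inv_sqrt :: "real^'n^'n \<Rightarrow> real^'n^'n" where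
  "inv_sqrt M = matrix_inv (psd_sqrt M)"

(* Phi(k,l) = A_{k-1} ... A_l if k \<ge> l (the identity if k = l), and
   Phi(k,l) = A_k^{-1} ... A_{l-1}^{-1} if k < l. *)
definition transition :: "(nat \<Rightarrow> real^'n^'n) \<Rightarrow> nat \<Rightarrow> nat \<Rightarrow> real^'n^'n" where
  "transition A k l =
     (if l \<le> k then foldr (**) (map A (rev [l..<k])) (mat 1)
      else foldr (**) (map (\<lambda>i. matrix_inv (A i)) [k..<l]) (mat 1))"

definition reach_gramian ::
  "(nat \<Rightarrow> real^'n^'n) \<Rightarrow> (nat \<Rightarrow> real^'m^'n) \<Rightarrow> nat \<Rightarrow> nat \<Rightarrow> real^'n^'n" where
  "reach_gramian A B k1 k0 =
     (\<Sum>k=k0..<k1. transition A k1 (k+1) ** B k ** transpose (B k) ** transpose (transition A k1 (k+1)))"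

definition contr_gramian ::
  "(nat \<Rightarrow> real^'n^'n) \<Rightarrow> (nat \<Rightarrow> real^'m^'n) \<Rightarrow> nat \<Rightarrow> nat \<Rightarrow> real^'n^'n" where
  "contr_gramian A B k1 k0 =
     (\<Sum>k=k0..<k1. transition A k0 (k+1) ** B k ** transpose (B k) ** transpose (transition A k0 (k+1)))"

definition Fmat :: "real^'n^'n \<Rightarrow> real^'n^'n \<Rightarrow> real^'n^'n" where
  "Fmat S0 SN = S0 + (1/2) *\<^sub>R mat 1
     - psd_sqrt (psd_sqrt S0 ** SN ** psd_sqrt S0 + (1/4) *\<^sub>R mat 1)"

definition Bmat :: "real^'n^'n \<Rightarrow> real^'n^'n \<Rightarrow> real^'n^'n" where
  "Bmat S0 SN = - S0 + (1/2) *\<^sub>R mat 1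
     + psd_sqrt (psd_sqrt S0 ** SN ** psd_sqrt S0 + (1/4) *\<^sub>R mat 1)"

(* The nondegenerate Gaussian N(mu, Sigma), for positive definite Sigma. *)
definition gaussian :: "real^'n \<Rightarrow> real^'n^'n \<Rightarrow> (real^'n) measure" where
  "gaussian \<mu> \<Sigma> = density lborel (\<lambda>x. ennreal
     (exp (- ((x - \<mu>) \<bullet> (matrix_inv \<Sigma> *v (x - \<mu>))) / 2) / sqrt ((2 * pi) ^ CARD('n) * det \<Sigma>)))"

(* On the probability space M, x satisfies x_{k+1} = A_k x_k + B_k w_k for k < N with
   x_0 ~ N(0, Sigma0), w_k ~ N(0, I) independent, and x_0 independent of (w_0, ..., w_{N-1}).
   The library's indep_var needs both variables to have the same type, so the last condition is
   stated for the generated sigma-algebras. *)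
definition linear_gaussian_process ::
  "'a measure \<Rightarrow> nat \<Rightarrow> (nat \<Rightarrow> real^'n^'n) \<Rightarrow> (nat \<Rightarrow> real^'m^'n) \<Rightarrow> real^'n^'n
    \<Rightarrow> (nat \<Rightarrow> 'a \<Rightarrow> real^'m) \<Rightarrow> (nat \<Rightarrow> 'a \<Rightarrow> real^'n) \<Rightarrow> bool" where
  "linear_gaussian_process M N A B \<Sigma>0 w x \<longleftrightarrow>
     prob_space M \<and>
     x 0 \<in> borel_measurable M \<and> distr M borel (x 0) = gaussian 0 \<Sigma>0 \<and>
     (\<forall>k<N. w k \<in> borel_measurable M \<and> distr M borel (w k) = gaussian 0 (mat 1)) \<and>
     prob_space.indep_vars M (\<lambda>_. borel) w {..<N} \<and>
     prob_space.indep_set M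
       {x 0 -` X \<inter> space M | X. X \<in> sets borel}
       {(\<lambda>\<omega>. \<lambda>k\<in>{..<N}. w k \<omega>) -` W \<inter> space M | W. W \<in> sets (PiM {..<N} (\<lambda>_. borel))} \<and>
     (\<forall>k<N. \<forall>\<omega>\<in>space M. x (Suc k) \<omega> = A k *v x k \<omega> + B k *v w k \<omega>)"

(* The path space of (N+1)-tuples x_0, ..., x_N, as extensional functions on {0..N}. *)
definition path_space :: "nat \<Rightarrow> (nat \<Rightarrow> real^'n) measure" where
  "path_space N = PiM {..N} (\<lambda>_. borel)"

definition path_law :: "'a measure \<Rightarrow> nat \<Rightarrow> (nat \<Rightarrow> 'a \<Rightarrow> real^'n) \<Rightarrow> (nat \<Rightarrow> real^'n) measure" where
  "path_law M N x = distr M (path_space N) (\<lambda>\<omega>. \<lambda>k\<in>{..N}. x k \<omega>)"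

(* D_KL(P || R) with natural logarithm and values in [0, \<infinity>]: the library's KL_divergence is
   real-valued and is 0 when the integral diverges. If P is absolutely continuous with respect
   to R, the negative part of log (dP/dR) is always P-integrable, so nonintegrability means
   that the integral is \<infinity>. *)
definition KL :: "'a measure \<Rightarrow> 'a measure \<Rightarrow> ereal" where
  "KL P R =
     (if absolutely_continuous R P \<and> integrable P (entropy_density (exp 1) R P)
      then ereal (KL_divergence (exp 1) R P) else \<infinity>)"

definition bridge_feasible ::
  "nat \<Rightarrow> real^'n^'n \<Rightarrow> real^'n^'n \<Rightarrow> (nat \<Rightarrow> real^'n) measure \<Rightarrow> bool" where
  "bridge_feasible N \<Sigma>0 \<Sigma>N P \<longleftrightarrow>
     prob_space P \<and> sets P = sets (path_space N :: (nat \<Rightarrow> real^'n) measure) \<and>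
     distr P borel (\<lambda>p. p 0) = gaussian 0 \<Sigma>0 \<and>
     distr P borel (\<lambda>p. p N) = gaussian 0 \<Sigma>N"

(* R is the law of the prior process. *)
definition bridge_optimal ::
  "nat \<Rightarrow> real^'n^'n \<Rightarrow> real^'n^'n \<Rightarrow> (nat \<Rightarrow> real^'n) measure \<Rightarrow> (nat \<Rightarrow> real^'n) measure \<Rightarrow> bool" where
  "bridge_optimal N \<Sigma>0 \<Sigma>N R P \<longleftrightarrow>
     bridge_feasible N \<Sigma>0 \<Sigma>N P \<and> (\<forall>P'. bridge_feasible N \<Sigma>0 \<Sigma>N P' \<longrightarrow> KL P R \<le> KL P' R)"

end

theory Submission
  imports Defs
begin

text \<open>
  Completing squares along the Riccati recursion shows that the closed-loop law has density
  \<open>exp \<phi>\<close> with respect to the prior law, where \<open>\<phi>\<close> is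
  a constant plus \<open>(x\<^sub>0 \<bullet> Q\<^sub>0\<^sup>-\<^sup>1 x\<^sub>0 - x\<^sub>N \<bullet> Q\<^sub>N\<^sup>-\<^sup>1 x\<^sub>N) / 2\<close>.
  It depends on the two endpoints separately, so its integral is the same for all feasible laws,
  and \<open>KL P R = KL P P* + \<integral>\<phi> dP\<close> makes \<open>P*\<close> the only minimiser.
  The matrices \<open>Q\<^sub>k\<close> stay invertible and the feedback stays well defined because
  \<open>G\<^sup>-\<^sup>1 - Q\<^sub>0\<^sup>-\<^sup>1\<close> is positive definite, and the terminal covariance comes out right because
  \<open>Q\<^sub>k\<^sup>-\<^sup>1 \<Sigma>\<^sub>k Q\<^sub>k\<^sup>-\<^sup>1 - Q\<^sub>k\<^sup>-\<^sup>1\<close> is transported by the uncontrolled dynamics.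
\<close>

subsection \<open>Positive definite matrices\<close>

text \<open>\<open>B k\<close> may have deficient rank, so transitions and path laws need not have
  Lebesgue densities. The comparison is therefore made on the noise: the closed-loop input has the
  form m + W^(-1/2) w, so both dynamics push a noise through the same \<open>B k\<close>, and only
  the nondegenerate laws N(m, W^-1) and N(0, I) have to be compared. The formula for
  \<open>Q 0\<close> solves the terminal condition. Put K = G^-1 - Q0^-1, with Q0 =
  \<open>Q 0\<close> and G the controllability Gramian over the whole horizon, and let Y be the
  terminal covariance carried back to time 0. The condition becomes K \<Sigma>0 K + K = G^-1 Y G^-1.
  The substitution K = G^(-1/2) S0^(-1/2) J S0^(-1/2) G^(-1/2) turns it into J^2 + J = S0^(1/2) SN
  S0^(1/2), and completing the square gives J = (S0^(1/2) SN S0^(1/2) + I/4)^(1/2) - I/2. So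
  \<open>Fmat S0 SN\<close> is S0 - J, and K is positive definite because J is. Positivity of K at
  time 0 controls all later times because carrying \<open>Q k\<close> back to time 0 turns the
  Riccati recursion into \<open>Q 0\<close> minus partial Gramians, all bounded by G.\<close>

declare transpose_matrix_vector [simp del] vector_transpose_matrix [simp del]

lemma matrix_sub_ldistrib: "A ** (B - C) = A ** B - A ** C" for A :: "real^'m^'n"
  by (vector matrix_matrix_mult_def sum_subtractf[symmetric] field_simps)

lemma matrix_sub_rdistrib: "(B - C) ** A = B ** A - C ** A" for A :: "real^'m^'n"
  by (vector matrix_matrix_mult_def sum_subtractf[symmetric] field_simps)

lemma matrix_add_rdistrib': "(B + C) ** A = B ** A + C ** A" for A :: "real^'m^'n"
  by (vector matrix_matrix_mult_def sum.distrib[symmetric] field_simps)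

lemma transpose_add: "transpose (A + B) = transpose A + transpose (B :: real^'m^'n)"
  by (vector transpose_def)

lemma transpose_diff: "transpose (A - B) = transpose A - transpose (B :: real^'m^'n)"
  by (vector transpose_def)

lemmas matrix_ring_simps =
  matrix_mul_assoc[symmetric] matrix_add_ldistrib matrix_add_rdistrib'
  matrix_sub_ldistrib matrix_sub_rdistrib

lemmas transpose_simps =
  matrix_transpose_mul transpose_add transpose_diff transpose_scalar

text \<open>Adjoints are kept in the column form \<open>transpose A *v y\<close>; the simp rules
  removed above would rewrite it to a row-vector product and block this rule.\<close>

lemma inner_matrix_vector_left: "(A *v x) \<bullet> y = x \<bullet> (transpose A *v y)"
  for A :: "real^'m^'n"
  by (metis dot_lmul_matrix transpose_matrix_vector transpose_transpose)

lemma matrix_inv_mult: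
  fixes A :: "real^'n^'n"
  assumes "invertible A"
  shows "A ** matrix_inv A = mat 1" "matrix_inv A ** A = mat 1"
proof -
  have "A ** matrix_inv A = mat 1 \<and> matrix_inv A ** A = mat 1"
    using assms unfolding invertible_def matrix_inv_def by (rule someI_ex)
  then show "A ** matrix_inv A = mat 1" "matrix_inv A ** A = mat 1" by auto
qed

lemma matrix_inv_cancel:
  fixes A :: "real^'n^'n" and X :: "real^'m^'n"
  assumes "invertible A"
  shows "A ** (matrix_inv A ** X) = X" "matrix_inv A ** (A ** X) = X"
  using matrix_inv_mult[OF assms] by (simp_all add: matrix_mul_assoc)

lemma matrix_inv_vector_cancel:
  fixes A :: "real^'n^'n"
  assumes "invertible A"
  shows "A *v (matrix_inv A *v x) = x" "matrix_inv A *v (A *v x) = x"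
  using matrix_inv_mult[OF assms] by (simp_all add: matrix_vector_mul_assoc)

lemma matrix_inv_eqI:
  fixes A B :: "real^'n^'n"
  assumes "A ** B = mat 1"
  shows "matrix_inv A = B"
proof -
  have "invertible A" using assms invertible_right_inverse by blast
  then have "matrix_inv A ** (A ** B) = B" by (rule matrix_inv_cancel)
  then show ?thesis using assms by simp
qed

lemma invertible_matrix_inv: "invertible (matrix_inv A)"
  if "invertible A" for A :: "real^'n^'n"
  using matrix_inv_mult[OF that] unfolding invertible_def by blast

lemma matrix_inv_matrix_inv: "matrix_inv (matrix_inv A) = A"
  if "invertible A" for A :: "real^'n^'n"
  by (rule matrix_inv_eqI) (rule matrix_inv_mult(2)[OF that])

lemma matrix_inv_matrix_mult:
  fixes A B :: "real^'n^'n"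
  assumes "invertible A" "invertible B"
  shows "matrix_inv (A ** B) = matrix_inv B ** matrix_inv A"
  by (rule matrix_inv_eqI)
    (simp add: matrix_mul_assoc[symmetric] matrix_inv_cancel matrix_inv_mult assms)

lemma matrix_inv_transpose:
  fixes A :: "real^'n^'n"
  assumes "invertible A"
  shows "matrix_inv (transpose A) = transpose (matrix_inv A)"
  by (rule matrix_inv_eqI) (metis assms matrix_inv_mult(2) matrix_transpose_mul transpose_mat)

lemma invertible_if_kernel_zero:
  fixes A :: "real^'n^'n"
  assumes "\<And>x. A *v x = 0 \<Longrightarrow> x = 0"
  shows "invertible A"
  using assms invertible_left_inverse matrix_left_invertible_ker by blast

lemma pos_defD:
  assumes "pos_def A"
  shows "transpose A = A" "x \<noteq> 0 \<Longrightarrow> 0 < x \<bullet> (A *v x)"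
  using assms by (auto simp: pos_def_def)

lemma pos_semidefD:
  assumes "pos_semidef A"
  shows "transpose A = A" "0 \<le> x \<bullet> (A *v x)"
  using assms by (auto simp: pos_semidef_def)

lemma pos_def_imp_semidef: "pos_semidef A" if "pos_def A"
proof -
  have "0 \<le> x \<bullet> (A *v x)" for x
    using pos_defD(2)[OF that, of x] by (cases "x = 0") auto
  then show ?thesis using pos_defD(1)[OF that] by (auto simp: pos_semidef_def)
qed

lemma pos_def_invertible: "invertible A" if "pos_def A"
  using pos_defD(2)[OF that] by (intro invertible_if_kernel_zero) force

text \<open>If x . Ax vanished while y = Ax did not, the form along x + t y would have slope 2 (y .
  y) at t = 0 and take negative values for small negative t.\<close>

lemma pos_def_if_semidef_invertible:
  assumes A: "pos_semidef A" and inv: "invertible A"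
  shows "pos_def A"
proof -
  have "0 < x \<bullet> (A *v x)" if "x \<noteq> 0" for x
  proof (rule ccontr)
    assume "\<not> ?thesis"
    then have x0: "x \<bullet> (A *v x) = 0" using pos_semidefD(2)[OF A, of x] by simp
    define y where "y = A *v x"
    have "y \<noteq> 0"
      unfolding y_def using that inv by (metis matrix_inv_vector_cancel(2) matrix_vector_mult_0_right)
    then have yy: "0 < y \<bullet> y" by simp
    have sym: "x \<bullet> (A *v y) = y \<bullet> y"
      using inner_matrix_vector_left[of A x y] pos_semidefD(1)[OF A] by (simp add: y_def)
    define c where "c = y \<bullet> (A *v y)"
    \<comment> \<open>The parabola 2 t (y . y) + t^2 c has its minimum at -(y . y) / c; the added 1
      keeps the denominator positive when c = 0.\<close>
    define t where "t = - (y \<bullet> y) / (c + 1)"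
    have c: "0 \<le> c" unfolding c_def by (rule pos_semidefD(2)[OF A])
    have "(x + t *\<^sub>R y) \<bullet> (A *v (x + t *\<^sub>R y)) = 2 * t * (y \<bullet> y) + t^2 * c"
      using x0 sym
      by (simp add: algebra_simps inner_add_left inner_add_right c_def power2_eq_square y_def[symmetric])
    also have "\<dots> = (y \<bullet> y)^2 / (c + 1) * (c / (c + 1) - 2)"
    proof -
      have "c + 1 \<noteq> 0" using c by simp
      then show ?thesis by (simp add: t_def divide_simps) (simp add: algebra_simps power2_eq_square)
    qed
    also have "\<dots> < 0"
      using yy c by (intro mult_pos_neg) (auto simp: field_simps)
    finally show False using pos_semidefD(2)[OF A, of "x + t *\<^sub>R y"] by simp
  qed
  then show ?thesis using pos_semidefD(1)[OF A] by (auto simp: pos_def_def)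
qed

lemma pos_def_mat_1: "pos_def (mat 1)"
  by (simp add: pos_def_def)

lemma pos_def_add_semidef: "pos_def (A + B)" if "pos_def A" "pos_semidef B"
  using that by (auto simp: pos_def_def pos_semidef_def transpose_add algebra_simps inner_add_right
      intro!: add_pos_nonneg)

lemma pos_def_scaleR: "pos_def (c *\<^sub>R A)" if "pos_def A" "0 < c"
  using that by (auto simp: pos_def_def transpose_scalar scaleR_matrix_vector_assoc[symmetric])

lemma pos_semidef_add: "pos_semidef (A + B)" if "pos_semidef A" "pos_semidef B"
  using that by (auto simp: pos_semidef_def transpose_add algebra_simps inner_add_right)

lemma pos_semidef_congruence: "pos_semidef (transpose B ** A ** B)" if "pos_semidef A"
  for A :: "real^'n^'n" and B :: "real^'m^'n"
proof -
  have "0 \<le> x \<bullet> (transpose B ** A ** B *v x)" for x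
    using pos_semidefD(2)[OF that, of "B *v x"]
    by (simp add: inner_matrix_vector_left matrix_vector_mul_assoc matrix_mul_assoc)
  then show ?thesis
    using pos_semidefD(1)[OF that] by (auto simp: pos_semidef_def transpose_simps matrix_mul_assoc)
qed

lemma pos_def_congruence: "pos_def (transpose B ** A ** B)" if "pos_def A" "invertible B"
  for A B :: "real^'n^'n"
proof (rule pos_def_if_semidef_invertible)
  show "pos_semidef (transpose B ** A ** B)"
    by (intro pos_semidef_congruence pos_def_imp_semidef that)
  show "invertible (transpose B ** A ** B)"
    by (intro invertible_mult transpose_invertible pos_def_invertible that)
qed

lemma pos_def_matrix_inv: "pos_def (matrix_inv A)" if "pos_def A"
proof -
  note inv = pos_def_invertible[OF that]
  have sym: "transpose (matrix_inv A) = matrix_inv A"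
    using matrix_inv_transpose[OF inv] pos_defD(1)[OF that] by simp
  have "transpose (matrix_inv A) ** A ** matrix_inv A = matrix_inv A"
    by (simp add: sym matrix_mul_assoc[symmetric] matrix_inv_mult[OF inv])
  then show ?thesis
    using pos_def_congruence[OF that invertible_matrix_inv[OF inv]] by simp
qed

lemma pos_semidef_gram: "pos_semidef (B ** transpose B)" for B :: "real^'m^'n"
  using pos_semidef_congruence[of "mat 1 :: real^'m^'m" "transpose B"] pos_def_imp_semidef[OF pos_def_mat_1]
  by simp

section \<open>Square roots of positive definite matrices\<close>

text \<open>By compactness the form attains a positive minimum on the unit sphere, and homogeneity
  extends the bound. It supplies the contraction constant for the root and the tail bound for
  Gaussian integrals.\<close>

lemma pos_def_lower_bound:
  fixes A :: "real^'n^'n"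
  assumes "pos_def A"
  obtains m where "0 < m" "\<And>x. m * (x \<bullet> x) \<le> x \<bullet> (A *v x)"
proof -
  let ?S = "sphere (0 :: real^'n) 1"
  have ne: "?S \<noteq> {}"
    by (metis empty_iff mem_sphere_0 vector_choose_size zero_le_one)
  have "continuous_on ?S (\<lambda>x. x \<bullet> (A *v x))"
    by (intro continuous_intros matrix_vector_mul_bounded_linear[THEN bounded_linear.continuous_on])
  from continuous_attains_inf[OF _ ne this] obtain z
    where z: "z \<in> ?S" "\<And>x. x \<in> ?S \<Longrightarrow> z \<bullet> (A *v z) \<le> x \<bullet> (A *v x)" by auto
  show ?thesis
  proof
    show "0 < z \<bullet> (A *v z)" using z(1) by (intro pos_defD(2)[OF assms]) force
    fix x :: "real^'n"
    show "z \<bullet> (A *v z) * (x \<bullet> x) \<le> x \<bullet> (A *v x)"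
    proof (cases "x = 0")
      case False
      then have "z \<bullet> (A *v z) \<le> ((1 / norm x) *\<^sub>R x) \<bullet> (A *v ((1 / norm x) *\<^sub>R x))"
        by (intro z(2)) simp
      also have "\<dots> = (x \<bullet> (A *v x)) / (x \<bullet> x)"
        by (simp add: algebra_simps dot_square_norm power2_eq_square)
      finally show ?thesis using False by (simp add: field_simps)
    qed simp
  qed
qed

lemma symmetric_root_unique:
  fixes R R' :: "real^'n^'n"
  assumes R: "pos_def R" and R': "pos_semidef R'" and eq: "R ** R = R' ** R'"
  shows "R = R'"
proof -
  define D where "D = R - R'"
  have Dsym: "transpose D = D"
    using R R' by (simp add: D_def transpose_diff pos_defD pos_semidefD)
  \<comment> \<open>D is symmetric, so a diagonal entry of D X D is the form of X at a column of
    D.\<close>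
  have tr: "trace (D ** X ** D) = (\<Sum>i\<in>UNIV. column i D \<bullet> (X *v column i D))" for X :: "real^'n^'n"
  proof -
    have "(D ** X ** D) $ i $ i = column i D \<bullet> (X *v column i D)" for i
    proof -
      have "(D ** X ** D) $ i $ i = axis i 1 \<bullet> ((D ** X ** D) *v axis i 1)"
        by (simp add: matrix_vector_mult_basis inner_axis' column_def)
      also have "\<dots> = (transpose D *v axis i 1) \<bullet> (X *v (D *v axis i 1))"
        by (simp add: inner_matrix_vector_left matrix_vector_mul_assoc matrix_mul_assoc)
      finally show ?thesis by (simp add: Dsym matrix_vector_mult_basis)
    qed
    then show ?thesis by (simp add: trace_def)
  qed
  have "R ** D + D ** R' = 0"
    by (simp add: D_def matrix_ring_simps eq)
  then have "D ** (R ** D + D ** R') = 0" by simp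
  then have "trace (D ** R ** D) + trace (D ** D ** R') = 0"
    by (metis matrix_add_ldistrib matrix_mul_assoc trace_add trace_0 mat_0)
  moreover have "trace (D ** D ** R') = trace (D ** R' ** D)"
    by (metis matrix_mul_assoc trace_mul_sym)
  ultimately have sum0: "(\<Sum>i\<in>UNIV. column i D \<bullet> (R *v column i D)) + (\<Sum>i\<in>UNIV. column i D \<bullet> (R' *v column i D)) = 0"
    by (simp add: tr)
  have nn: "0 \<le> column i D \<bullet> (R *v column i D)" for i
    by (intro pos_semidefD(2) pos_def_imp_semidef R)
  have "0 \<le> (\<Sum>i\<in>UNIV. column i D \<bullet> (R' *v column i D))"
    by (intro sum_nonneg pos_semidefD(2) R')
  moreover have "0 \<le> (\<Sum>i\<in>UNIV. column i D \<bullet> (R *v column i D))"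
    by (intro sum_nonneg nn)
  ultimately have "(\<Sum>i\<in>UNIV. column i D \<bullet> (R *v column i D)) = 0" using sum0 by linarith
  then have "column i D \<bullet> (R *v column i D) = 0" for i
    by (simp add: sum_nonneg_eq_0_iff nn)
  then have "column i D = 0" for i
    using pos_defD(2)[OF R, of "column i D"] by force
  then have "D = 0" by (simp add: vec_eq_iff column_def)
  then show ?thesis by (simp add: D_def)
qed

text \<open>After scaling, the root of \<open>1 - E\<close> with \<open>\<parallel>E\<parallel> < 1\<close> is \<open>1 - Y\<close>, where \<open>Y\<close> is
  the fixed point of the contraction \<open>Y \<mapsto> (E + Y\<^sup>2) / 2\<close>.\<close>

lemma pos_def_root_exists:
  fixes A :: "real^'n^'n"
  assumes A: "pos_def A"
  obtains R where "pos_def R" "R ** R = A"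
proof -
  obtain m where m: "0 < m" "\<And>x. m * (x \<bullet> x) \<le> x \<bullet> (A *v x)"
    using pos_def_lower_bound[OF A] by blast
  obtain L where L: "0 < L" "\<And>x. norm (A *v x) \<le> norm x * L"
    using bounded_linear.pos_bounded[OF matrix_vector_mul_bounded_linear[of A]] by blast
  \<comment> \<open>This scale minimises the bound 1 - 2 m / c + L^2 / c^2 on the squared norm of 1
    - A / c; the minimum is 1 - m^2 / L^2.\<close>
  define c where "c = L^2 / m"
  have c: "0 < c" using L(1) m(1) by (simp add: c_def)
  \<comment> \<open>The clipping at 0 keeps the root meaningful without a proof that m is at most
    L.\<close>
  define e where "e = sqrt (max 0 (1 - m^2 / L^2))"
  have e: "0 \<le> e" "e < 1"
    using m(1) L(1) by (auto simp: e_def)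
  define E :: "(real^'n) \<Rightarrow>\<^sub>L (real^'n)" where "E = Blinfun (\<lambda>x. x - (1 / c) *\<^sub>R (A *v x))"
  have E: "blinfun_apply E x = x - (1 / c) *\<^sub>R (A *v x)" for x
    unfolding E_def
    by (subst bounded_linear_Blinfun_apply) (auto intro!: bounded_linear_intros)
  have normE: "norm E \<le> e"
  proof (rule norm_blinfun_bound[OF e(1)])
    fix x
    have "(norm (E x))^2 = x \<bullet> x - 2 / c * (x \<bullet> (A *v x)) + (1 / c)^2 * (norm (A *v x))^2"
      unfolding power2_norm_eq_inner E
      by (simp add: inner_diff_left inner_diff_right inner_commute[of "A *v x" x] power2_eq_square
          power2_norm_eq_inner diff_divide_distrib)
    also have "\<dots> \<le> x \<bullet> x - 2 / c * (m * (x \<bullet> x)) + (1 / c)^2 * (norm x * L)^2"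
      using m(2)[of x] L(2)[of x] c
      by (intro add_mono diff_mono mult_left_mono power_mono) auto
    also have "\<dots> = (1 - m^2 / L^2) * (x \<bullet> x)"
      using m(1) L(1) by (simp add: c_def power2_norm_eq_inner field_simps power2_eq_square dot_square_norm)
    also have "\<dots> \<le> (max 0 (1 - m^2 / L^2)) * (x \<bullet> x)"
      by (intro mult_right_mono) auto
    also have "\<dots> = (e * norm x)^2"
      by (simp add: e_def power_mult_distrib power2_norm_eq_inner)
    finally show "norm (E x) \<le> e * norm x"
      using e(1) power2_le_imp_le by (metis mult_nonneg_nonneg norm_ge_zero)
  qed
  \<comment> \<open>The smaller root of r^2 - 2 r + e = 0: the iteration then maps the ball of
    radius r into itself and has Lipschitz constant r < 1 there.\<close>
  define r where "r = 1 - sqrt (1 - e)"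
  have r: "0 \<le> r" "r < 1" "(e + r^2) / 2 = r"
    using e by (auto simp: r_def power2_eq_square algebra_simps diff_divide_distrib)
  define f where "f Y = (1/2) *\<^sub>R (E + (Y o\<^sub>L Y))" for Y
  \<comment> \<open>Symmetry is a closed condition preserved by the iteration, so the fixed point
    inherits it.\<close>
  define S where "S = {Y :: (real^'n) \<Rightarrow>\<^sub>L (real^'n). norm Y \<le> r \<and>
    (\<forall>x y. blinfun_apply Y x \<bullet> y = x \<bullet> blinfun_apply Y y)}"
  have "\<exists>!Y\<in>S. f Y = Y"
  proof (rule Banach_fix)
    have "S = {Y. norm Y \<le> r} \<inter> (\<Inter>x. \<Inter>y. {Y. blinfun_apply Y x \<bullet> y = x \<bullet> blinfun_apply Y y})"
      by (auto simp: S_def)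
    also have "closed \<dots>"
      by (intro closed_Int closed_INT ballI closed_Collect_le closed_Collect_eq continuous_intros)
    finally show "uniform_space_class.complete S" by (simp add: complete_eq_closed)
    have "0 \<in> S" using r by (simp add: S_def)
    then show "S \<noteq> {}" by blast
    show "0 \<le> r" "r < 1" by fact+
    show "f ` S \<subseteq> S"
    proof safe
      fix Y assume Y: "Y \<in> S"
      have "norm (f Y) \<le> (norm E + norm (Y o\<^sub>L Y)) / 2"
        by (simp add: f_def norm_triangle_ineq)
      also have "\<dots> \<le> (e + r * r) / 2"
      proof -
        have "norm (Y o\<^sub>L Y) \<le> r * r"
          using Y r by (intro order.trans[OF norm_blinfun_compose] mult_mono) (auto simp: S_def)
        then show ?thesis using normE by simp
      qed
      also have "\<dots> = r" using r(3) by (simp add: power2_eq_square)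
      finally have "norm (f Y) \<le> r" .
      moreover have "E x \<bullet> y = x \<bullet> E y" for x y
        using inner_matrix_vector_left[of A x y] pos_defD(1)[OF A]
        by (simp add: E inner_diff_left inner_diff_right)
      then have "f Y x \<bullet> y = x \<bullet> f Y y" for x y
        using Y by (simp add: f_def S_def blinfun.bilinear_simps inner_add_left inner_add_right)
      ultimately show "f Y \<in> S" by (simp add: S_def)
    qed
    show "dist (f Y) (f Z) \<le> r * dist Y Z" if "Y \<in> S" "Z \<in> S" for Y Z
    proof -
      have "f Y - f Z = (1/2) *\<^sub>R ((Y o\<^sub>L (Y - Z)) + ((Y - Z) o\<^sub>L Z))"
        by (rule blinfun_eqI) (simp add: f_def blinfun.bilinear_simps algebra_simps)
      then have "norm (f Y - f Z) = norm ((Y o\<^sub>L (Y - Z)) + ((Y - Z) o\<^sub>L Z)) / 2" by simp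
      also have "\<dots> \<le> (norm Y * norm (Y - Z) + norm (Y - Z) * norm Z) / 2"
        by (intro divide_right_mono order.trans[OF norm_triangle_ineq] add_mono norm_blinfun_compose) auto
      also have "\<dots> \<le> (r * norm (Y - Z) + norm (Y - Z) * r) / 2"
        using that by (intro divide_right_mono add_mono mult_mono) (auto simp: S_def r)
      finally show ?thesis by (simp add: dist_norm)
    qed
  qed
  then obtain Y where Y: "norm Y \<le> r" "f Y = Y"
      "\<And>x y. blinfun_apply Y x \<bullet> y = x \<bullet> blinfun_apply Y y"
    by (auto simp: S_def)
  define R where "R = matrix (\<lambda>x. sqrt c *\<^sub>R (x - Y x))"
  have R: "R *v x = sqrt c *\<^sub>R (x - Y x)" for x
  proof -
    have "linear (\<lambda>x. sqrt c *\<^sub>R (x - Y x))"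
      by (intro bounded_linear.linear bounded_linear_intros)
    then show ?thesis unfolding R_def
      using matrix_vector_mul(2)[of "\<lambda>x. sqrt c *\<^sub>R (x - Y x)"] by metis
  qed
  show ?thesis
  proof
    have "(R *v x) \<bullet> y = x \<bullet> (R *v y)" for x y
      by (simp add: R Y(3) inner_diff_left inner_diff_right)
    then have "transpose R *v y = R *v y" for y
      by (metis inner_commute inner_matrix_vector_left vector_eq_ldot)
    then have "transpose R = R" by (simp add: matrix_eq)
    moreover have "0 < x \<bullet> (R *v x)" if "x \<noteq> 0" for x
    proof -
      have "x \<bullet> Y x \<le> norm x * (norm Y * norm x)"
        by (intro order.trans[OF norm_cauchy_schwarz] mult_left_mono norm_blinfun) auto
      also have "\<dots> \<le> norm x * (r * norm x)"
        using Y(1) by (intro mult_left_mono mult_right_mono) auto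
      also have "\<dots> < x \<bullet> x"
        using that r(2) by (simp add: dot_square_norm power2_eq_square)
      finally show ?thesis using c by (simp add: R inner_diff_right)
    qed
    ultimately show "pos_def R" by (auto simp: pos_def_def)
    have "(R ** R) *v x = A *v x" for x
    proof -
      have fix2: "2 *\<^sub>R Y x = E x + Y (Y x)"
        using arg_cong[OF Y(2), of "\<lambda>Z. 2 *\<^sub>R blinfun_apply Z x"]
        by (simp add: f_def blinfun.bilinear_simps)
      have "(R ** R) *v x = c *\<^sub>R (x - 2 *\<^sub>R Y x + Y (Y x))"
        using c by (simp add: matrix_vector_mul_assoc[symmetric] R blinfun.bilinear_simps
            algebra_simps scaleR_2)
      also have "\<dots> = A *v x"
        using c by (simp add: fix2 E algebra_simps)
      finally show ?thesis .
    qed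
    then show "R ** R = A" by (simp add: matrix_eq)
  qed
qed

text \<open>This discharges the definite description in \<open>psd_sqrt\<close>: existence supplies
  a positive definite root, and uniqueness compares it with every semidefinite one.\<close>

lemma psd_sqrt_pos_def:
  fixes A :: "real^'n^'n"
  assumes "pos_def A"
  shows "pos_def (psd_sqrt A)" "psd_sqrt A ** psd_sqrt A = A"
proof -
  obtain R where R: "pos_def R" "R ** R = A" using pos_def_root_exists[OF assms] .
  have "psd_sqrt A = R"
    unfolding psd_sqrt_def
  proof (rule the_equality)
    show "pos_semidef R \<and> R ** R = A" using R pos_def_imp_semidef by blast
    show "R' = R" if "pos_semidef R' \<and> R' ** R' = A" for R'
      using symmetric_root_unique[of R R'] R that by simp
  qed
  then show "pos_def (psd_sqrt A)" "psd_sqrt A ** psd_sqrt A = A" using R by simp_all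
qed

lemma inv_sqrt_pos_def:
  fixes A :: "real^'n^'n"
  assumes "pos_def A"
  shows "pos_def (inv_sqrt A)" "inv_sqrt A ** inv_sqrt A = matrix_inv A"
    "inv_sqrt A ** psd_sqrt A = mat 1" "psd_sqrt A ** inv_sqrt A = mat 1"
proof -
  note R = psd_sqrt_pos_def[OF assms]
  note inv = pos_def_invertible[OF R(1)]
  show "pos_def (inv_sqrt A)" unfolding inv_sqrt_def by (rule pos_def_matrix_inv[OF R(1)])
  show "inv_sqrt A ** inv_sqrt A = matrix_inv A"
    unfolding inv_sqrt_def by (subst R(2)[symmetric]) (simp add: matrix_inv_matrix_mult inv)
  show "inv_sqrt A ** psd_sqrt A = mat 1" "psd_sqrt A ** inv_sqrt A = mat 1"
    unfolding inv_sqrt_def by (simp_all add: matrix_inv_mult inv)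
qed

text \<open>The determinant is the square of the determinant of the root, which is
  invertible.\<close>

lemma det_pos_def: "0 < det A" if "pos_def A"
proof -
  note R = psd_sqrt_pos_def[OF that]
  have "det A = det (psd_sqrt A) * det (psd_sqrt A)" by (subst R(2)[symmetric]) (rule det_mul)
  moreover have "det (psd_sqrt A) \<noteq> 0"
    using pos_def_invertible[OF R(1)] invertible_det_nz by blast
  ultimately show ?thesis by (auto simp: zero_less_mult_iff linorder_neq_iff)
qed

subsection \<open>Gramians and the Riccati recursion\<close>

lemma foldr_matrix_mult:
  "foldr (**) xs Y = foldr (**) xs (mat 1) ** Y" for Y :: "real^'n^'n"
  by (induction xs) (simp_all add: matrix_mul_assoc[symmetric])

lemma transition_self: "transition A k k = mat 1"
  by (simp add: transition_def)

lemma transition_0_Suc: "transition A 0 (Suc k) = transition A 0 k ** matrix_inv (A k)"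
proof -
  have "transition A 0 (Suc k) = foldr (**) (map (\<lambda>i. matrix_inv (A i)) [0..<k]) (matrix_inv (A k))"
    by (simp add: transition_def)
  also have "\<dots> = foldr (**) (map (\<lambda>i. matrix_inv (A i)) [0..<k]) (mat 1) ** matrix_inv (A k)"
    by (rule foldr_matrix_mult)
  \<comment> \<open>\<open>transition A 0 k\<close> takes the first branch of its definition, the
    identity, at \<open>k = 0\<close> and the branch of inverses for all larger
    \<open>k\<close>.\<close>
  finally show ?thesis by (cases k) (simp_all add: transition_def)
qed

lemma transition_Suc: "l \<le> k \<Longrightarrow> transition A (Suc k) l = A k ** transition A k l"
  by (simp add: transition_def)

lemma invertible_transition_0:
  assumes "\<forall>i<k. invertible (A i)"
  shows "invertible (transition A 0 k)"
  using assms
proof (induction k)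
  case 0
  show ?case unfolding transition_self invertible_def by (intro exI[of _ "mat 1"]) simp
next
  case (Suc k)
  then show ?case
    unfolding transition_0_Suc by (intro invertible_mult invertible_matrix_inv) auto
qed

text \<open>Each induction step cancels the adjacent pair \<open>matrix_inv (A k)\<close> and
  \<open>A k\<close>.\<close>

lemma transition_0_trans:
  assumes "\<forall>i<k. invertible (A i)" "l \<le> k"
  shows "transition A 0 k ** transition A k l = transition A 0 l"
  using assms(2,1)
proof (induction k rule: dec_induct)
  case base
  then show ?case by (simp add: transition_self)
next
  case (step k)
  then show ?case
    by (simp add: transition_0_Suc transition_Suc matrix_mul_assoc[symmetric] matrix_inv_cancel)
qed

lemma matrix_sum_sandwich:
  fixes L :: "real^'n^'n"
  shows "L ** (\<Sum>i\<in>I. f i) ** R = (\<Sum>i\<in>I. L ** f i ** R)"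
  by (induction I rule: infinite_finite_induct) (simp_all add: matrix_ring_simps)

lemma contr_gramian_eq_reach_gramian:
  assumes "\<forall>i<N. invertible (A i)"
  shows "contr_gramian A B N 0 =
    transition A 0 N ** reach_gramian A B N 0 ** transpose (transition A 0 N)"
proof -
  have "transition A 0 N ** (transition A N (k+1) ** B k ** transpose (B k) ** transpose (transition A N (k+1)))
      ** transpose (transition A 0 N)
    = transition A 0 (k+1) ** B k ** transpose (B k) ** transpose (transition A 0 (k+1))" if "k < N" for k
  proof -
    have "transition A 0 (k+1) = transition A 0 N ** transition A N (k+1)"
      using that by (intro transition_0_trans[OF assms, symmetric]) simp
    then show ?thesis
      by (simp only: matrix_transpose_mul matrix_mul_assoc)
  qed
  then show ?thesis
    by (simp add: contr_gramian_def reach_gramian_def matrix_sum_sandwich)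
qed

lemma pos_semidef_sum: "(\<And>i. i \<in> I \<Longrightarrow> pos_semidef (f i)) \<Longrightarrow> pos_semidef (\<Sum>i\<in>I. f i)"
proof (induction I rule: infinite_finite_induct)
  case (insert x F)
  then show ?case by (auto intro!: pos_semidef_add)
qed (simp_all add: pos_semidef_def transpose_def vec_eq_iff)

lemma pos_semidef_gramian_term: "pos_semidef (P ** B ** transpose B ** transpose P)"
  for P :: "real^'n^'n" and B :: "real^'m^'n"
  using pos_semidef_gram[of "P ** B"] by (simp add: matrix_transpose_mul matrix_mul_assoc)

lemma pos_semidef_contr_gramian: "pos_semidef (contr_gramian A B k 0)"
  unfolding contr_gramian_def by (intro pos_semidef_sum pos_semidef_gramian_term)

lemma contr_gramian_Suc:
  "contr_gramian A B (Suc k) 0 = contr_gramian A B k 0 +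
    transition A 0 (Suc k) ** B k ** transpose (transition A 0 (Suc k) ** B k)"
  by (simp add: contr_gramian_def matrix_transpose_mul matrix_mul_assoc)

text \<open>The bound under which \<open>riccati_no_escape\<close> keeps every carried-back
  \<open>Q k\<close> invertible.\<close>

lemma contr_gramian_mono:
  assumes "k \<le> N"
  shows "pos_semidef (contr_gramian A B N 0 - contr_gramian A B k 0)"
proof -
  have "{0..<N} = {0..<k} \<union> {k..<N}" using assms by auto
  then have "contr_gramian A B N 0 - contr_gramian A B k 0 =
    (\<Sum>i=k..<N. transition A 0 (i+1) ** B i ** transpose (B i) ** transpose (transition A 0 (i+1)))"
    unfolding contr_gramian_def by (simp add: sum.union_disjoint)
  then show ?thesis by (simp add: pos_semidef_sum pos_semidef_gramian_term)
qed

text \<open>Congruence by \<open>transition A 0 N\<close> transfers invertibility from the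
  reachability Gramian, where it is assumed, to the controllability Gramian.\<close>

lemma pos_def_contr_gramian:
  assumes "\<forall>i<N. invertible (A i)" "invertible (reach_gramian A B N 0)"
  shows "pos_def (contr_gramian A B N 0)"
proof (rule pos_def_if_semidef_invertible[OF pos_semidef_contr_gramian])
  show "invertible (contr_gramian A B N 0)"
    unfolding contr_gramian_eq_reach_gramian[OF assms(1)]
    by (intro invertible_mult transpose_invertible invertible_transition_0 assms)
qed

text \<open>With \<open>s = Q u\<close> and \<open>y = (Q - G) u\<close> one has
  \<open>u \<bullet> (Q - G) u + y \<bullet> G\<^sup>-\<^sup>1 y = s \<bullet> (G\<^sup>-\<^sup>1 - Q\<^sup>-\<^sup>1) s\<close>,
  and completing a square bounds \<open>y \<bullet> G\<^sup>-\<^sup>1 y\<close> by the Gramian increments.\<close>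

lemma riccati_no_escape:
  fixes G Q :: "real^'n^'n" and b :: "real^'m^'n"
  assumes G: "pos_def G" and Q: "invertible Q" "transpose Q = Q"
    and K: "pos_def (matrix_inv G - matrix_inv Q)"
  shows "\<lbrakk>pos_semidef g; pos_semidef (G - g)\<rbrakk> \<Longrightarrow> invertible (Q - g)"
    and "\<lbrakk>pos_semidef g; pos_semidef (G - (g + b ** transpose b))\<rbrakk> \<Longrightarrow>
      pos_def (mat 1 + transpose b ** matrix_inv (Q - (g + b ** transpose b)) ** b)"
proof -
  define K where "K = matrix_inv G - matrix_inv Q"
  note Gi = pos_def_invertible[OF G]
  have Kx: "x \<bullet> (K *v x) = x \<bullet> (matrix_inv G *v x) - x \<bullet> (matrix_inv Q *v x)" for x
    by (simp add: K_def algebra_simps inner_diff_right)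
  have Kpos: "x \<noteq> 0 \<Longrightarrow> 0 < x \<bullet> (K *v x)" for x
    using pos_defD(2)[OF K] by (simp add: K_def)
  show inv: "invertible (Q - g)" if g: "pos_semidef g" "pos_semidef (G - g)" for g
  proof (rule invertible_if_kernel_zero)
    fix v assume "(Q - g) *v v = 0"
    then have qv: "Q *v v = g *v v" by (simp add: algebra_simps)
    define u where "u = Q *v v"
    define a where "a = matrix_inv G *v u"
    have v: "v = matrix_inv Q *v u" by (simp add: u_def matrix_inv_vector_cancel Q)
    have ga: "a \<bullet> (g *v a) \<le> u \<bullet> (matrix_inv G *v u)"
      using pos_semidefD(2)[OF g(2), of a]
      by (simp add: a_def matrix_vector_mult_diff_rdistrib inner_diff_right matrix_inv_vector_cancel Gi
          inner_commute[of "matrix_inv G *v u" u])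
    \<comment> \<open>Expanding this square and using the bound for g at a gives u . G^-1 u \<le> u
      . Q^-1 u, which contradicts positivity of K unless u = 0.\<close>
    have "0 \<le> (v - a) \<bullet> (g *v (v - a))" by (rule pos_semidefD(2)[OF g(1)])
    also have "\<dots> = v \<bullet> u - 2 * (a \<bullet> u) + a \<bullet> (g *v a)"
      using inner_matrix_vector_left[of g v a] pos_semidefD(1)[OF g(1)] qv
      by (simp add: algebra_simps inner_diff_left inner_diff_right u_def[symmetric] inner_commute)
    finally have "u \<bullet> (K *v u) \<le> 0"
      using ga unfolding Kx v[symmetric] by (simp add: a_def inner_commute)
    then have "u = 0" using Kpos[of u] by force
    then show "v = 0" by (simp add: v)
  qed
  assume g: "pos_semidef g" "pos_semidef (G - (g + b ** transpose b))"
  \<comment> \<open>\<open>g'\<close> is the next partial Gramian and D the part of G still to come,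
    so G = g + b b^T + D.\<close>
  define g' where "g' = g + b ** transpose b"
  define D where "D = G - g'"
  define q where "q = Q - g'"
  have D: "pos_semidef D" using g by (simp add: D_def g'_def)
  have g': "pos_semidef g'" unfolding g'_def by (intro pos_semidef_add g(1) pos_semidef_gram)
  have q: "invertible q" unfolding q_def by (rule inv) (use g' D in \<open>simp_all add: D_def\<close>)
  have qsym: "transpose q = q"
    using Q pos_semidefD(1)[OF g'] by (simp add: q_def transpose_diff)
  have "transpose (mat 1 + transpose b ** matrix_inv q ** b) = mat 1 + transpose b ** matrix_inv q ** b"
    using matrix_inv_transpose[OF q] by (simp add: transpose_simps matrix_mul_assoc qsym)
  moreover have "0 < v \<bullet> ((mat 1 + transpose b ** matrix_inv q ** b) *v v)" if v: "v \<noteq> 0" for v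
  proof -
    \<comment> \<open>The form at v equals v . v + u . qu with q = (Q - G) + D, and only the part u
      . (Q - G) u can be negative.\<close>
    define u where "u = matrix_inv q *v (b *v v)"
    define s where "s = Q *v u"
    define y where "y = b *v v - D *v u"
    define a where "a = matrix_inv G *v y"
    have bv: "b *v v = q *v u" by (simp add: u_def matrix_inv_vector_cancel q)
    have u: "u = matrix_inv Q *v s" by (simp add: s_def matrix_inv_vector_cancel Q)
    have y: "y = s - G *v u"
      by (simp add: y_def bv q_def D_def s_def algebra_simps)
    have form: "v \<bullet> ((mat 1 + transpose b ** matrix_inv q ** b) *v v) = v \<bullet> v + u \<bullet> (q *v u)"
      using inner_matrix_vector_left[of b v u]
      by (simp add: algebra_simps inner_add_right matrix_vector_mul_assoc[symmetric] u_def[symmetric]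
          bv[symmetric] inner_commute)
    have yGy: "y \<bullet> (matrix_inv G *v y) + u \<bullet> ((Q - G) *v u) = s \<bullet> (K *v s)"
    proof -
      have "(G *v u) \<bullet> (matrix_inv G *v s) = u \<bullet> s"
        by (simp add: inner_matrix_vector_left pos_defD(1)[OF G] matrix_inv_vector_cancel Gi)
      then show ?thesis
        by (simp add: y Kx u[symmetric] matrix_vector_mult_diff_distrib matrix_vector_mult_diff_rdistrib
            inner_diff_left inner_diff_right matrix_inv_vector_cancel Gi s_def[symmetric])
          (simp add: inner_commute)
    qed
    \<comment> \<open>Minimum-energy argument: y = b v + D (-u) is produced at energy v . v + u .
      Du, and b b^T + D is bounded by G, hence y . G^-1 y is at most that energy.\<close>
    have "0 \<le> (transpose b *v a - v) \<bullet> (transpose b *v a - v) + (a + u) \<bullet> (D *v (a + u))"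
      by (intro add_nonneg_nonneg pos_semidefD(2)[OF D]) simp
    also have "\<dots> = a \<bullet> ((b ** transpose b + D) *v a) - 2 * (a \<bullet> y) + v \<bullet> v + u \<bullet> (D *v u)"
      using inner_matrix_vector_left[of D a u] pos_semidefD(1)[OF D]
        inner_matrix_vector_left[of b v a] inner_matrix_vector_left[of b "transpose b *v a" a]
      by (simp add: y_def algebra_simps inner_diff_left inner_diff_right inner_add_left inner_add_right
          inner_commute matrix_vector_mul_assoc[symmetric])
    also have "a \<bullet> ((b ** transpose b + D) *v a) \<le> a \<bullet> (G *v a)"
      using pos_semidefD(2)[OF g(1), of a] by (simp add: D_def g'_def algebra_simps inner_diff_right inner_add_right)
    also have "a \<bullet> (G *v a) = a \<bullet> y" by (simp add: a_def matrix_inv_vector_cancel Gi)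
    finally have "y \<bullet> (matrix_inv G *v y) \<le> v \<bullet> v + u \<bullet> (D *v u)"
      by (simp add: a_def inner_commute)
    then have le: "s \<bullet> (K *v s) \<le> v \<bullet> v + u \<bullet> (q *v u)"
      using yGy by (simp add: q_def D_def algebra_simps inner_diff_right)
    show ?thesis
    proof (cases "u = 0")
      case True
      then show ?thesis using v by (simp add: form)
    next
      case False
      then have "s \<noteq> 0" using u by auto
      then show ?thesis using Kpos[of s] le by (simp add: form)
    qed
  qed
  ultimately show "pos_def (mat 1 + transpose b ** matrix_inv (Q - (g + b ** transpose b)) ** b)"
    by (auto simp: pos_def_def q_def g'_def)
qed

section \<open>One step of the Riccati recursion\<close>

context
  fixes A Q Q' F :: "real^'n^'n" and B :: "real^'m^'n" and W :: "real^'m^'m"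
  assumes A: "invertible A" and Q: "invertible Q" "transpose Q = Q"
    and Q': "invertible Q'" "Q' = A ** Q ** transpose A - B ** transpose B"
    and W: "pos_def W" "W = mat 1 + transpose B ** matrix_inv Q' ** B"
    and F: "F = A - B ** matrix_inv W ** transpose B ** matrix_inv Q' ** A"
begin

private abbreviation (input) "At \<equiv> matrix_inv (transpose A)"

private lemma AQA: "A ** (Q ** transpose A) = Q' + B ** transpose B"
  using Q'(2) by (simp add: matrix_mul_assoc)

private lemma Q'_sym: "transpose Q' = Q'" "transpose (matrix_inv Q') = matrix_inv Q'"
proof -
  show *: "transpose Q' = Q'" unfolding Q'(2) by (simp add: transpose_simps Q matrix_mul_assoc)
  show "transpose (matrix_inv Q') = matrix_inv Q'"
    using matrix_inv_transpose[OF Q'(1)] by (simp add: *)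
qed

private lemma Qi_sym: "transpose (matrix_inv Q) = matrix_inv Q"
  using matrix_inv_transpose[OF Q(1)] Q(2) by simp

private lemma AtT: "invertible (transpose A)" by (rule transpose_invertible[OF A])

private lemma AtT': "transpose (matrix_inv (transpose A)) = matrix_inv A"
  using matrix_inv_transpose[OF AtT] by simp

private lemmas cancels = matrix_inv_mult[OF A] matrix_inv_mult[OF Q(1)] matrix_inv_mult[OF Q'(1)]
  matrix_inv_mult[OF AtT] matrix_inv_cancel[OF A] matrix_inv_cancel[OF Q(1)] matrix_inv_cancel[OF Q'(1)]
  matrix_inv_cancel[OF AtT] matrix_inv_mult[OF pos_def_invertible[OF W(1)]]
  matrix_inv_cancel[OF pos_def_invertible[OF W(1)]]

text \<open>This is the Woodbury identity: the right side is Q' - Q' (A Q A^T)^-1 Q', where A Q A^T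
  = Q' + B B^T. It follows from B W = (Q' + B B^T) Q'^-1 B by moving W and A Q A^T to the other
  sides.\<close>

lemma riccati_noise:
  "B ** matrix_inv W ** transpose B = Q' - Q' ** At ** matrix_inv Q ** matrix_inv A ** Q'"
proof -
  have "B ** W = (Q' + B ** transpose B) ** (matrix_inv Q' ** B)"
    by (simp add: W(2) matrix_ring_simps cancels)
  also have "\<dots> = A ** (Q ** (transpose A ** (matrix_inv Q' ** B)))"
    by (simp add: AQA[symmetric] matrix_mul_assoc)
  finally have "Q' ** (At ** (matrix_inv Q ** (matrix_inv A ** (B ** W)))) = B"
    by (simp add: cancels)
  then have "B ** matrix_inv W = Q' ** (At ** (matrix_inv Q ** (matrix_inv A ** (B ** W)))) ** matrix_inv W"
    by simp
  also have "\<dots> = Q' ** (At ** (matrix_inv Q ** (matrix_inv A ** B)))"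
    by (simp add: matrix_mul_assoc[symmetric] cancels)
  finally have "B ** matrix_inv W ** transpose B =
      Q' ** (At ** (matrix_inv Q ** (matrix_inv A ** (A ** (Q ** transpose A) - Q'))))"
    by (simp add: AQA matrix_mul_assoc[symmetric])
  also have "\<dots> = Q' - Q' ** At ** matrix_inv Q ** matrix_inv A ** Q'"
    by (simp add: matrix_ring_simps cancels)
  finally show ?thesis .
qed

text \<open>Q and Q' intertwine the closed loop with the adjoint dynamics A^-T. This shows that F is
  invertible and makes products such as F Q collapse.\<close>

lemma riccati_closed_loop: "F = Q' ** At ** matrix_inv Q"
  unfolding F riccati_noise by (simp add: matrix_ring_simps cancels)

lemma riccati_backward: "matrix_inv Q = transpose A ** matrix_inv Q' ** F"
  unfolding riccati_closed_loop by (simp add: matrix_mul_assoc[symmetric] cancels)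

text \<open>Since F Q = Q' A^-T, the term F Q F^T is exactly what the Woodbury form of the noise
  covariance subtracts from Q', and the Y part sees only A.\<close>

lemma riccati_covariance:
  "F ** (Q ** Y ** Q + Q) ** transpose F + B ** matrix_inv W ** transpose B =
    Q' ** (At ** Y ** matrix_inv A) ** Q' + Q'"
  unfolding riccati_noise riccati_closed_loop
  by (simp add: matrix_ring_simps transpose_simps cancels Q'_sym Qi_sym AtT')

text \<open>Twice the log ratio of tilted to standard noise, up to its normaliser, becomes a
  difference of quadratic forms at consecutive states, which telescopes along a path. The gain
  satisfies W U = B^T Q'^-1 A x, so the cross terms agree, and \<open>riccati_backward\<close>
  accounts for the pure x terms.\<close>

lemma riccati_complete_square:
  fixes x :: "real^'n" and w :: "real^'m"
  defines "v \<equiv> w + (matrix_inv W ** transpose B ** matrix_inv Q' ** A) *v x"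
  shows "w \<bullet> w - v \<bullet> (W *v v) - x \<bullet> (matrix_inv Q *v x) =
    - ((A *v x + B *v w) \<bullet> (matrix_inv Q' *v (A *v x + B *v w)))"
proof -
  define P where "P = matrix_inv Q'"
  define U where "U = (matrix_inv W ** transpose B ** P ** A) *v x"
  have WU: "W *v U = transpose B *v (P *v (A *v x))"
    by (simp add: U_def matrix_vector_mul_assoc matrix_mul_assoc[symmetric] cancels)
  have Ww: "W *v w = w + transpose B *v (P *v (B *v w))"
    by (simp add: W(2) P_def algebra_simps matrix_vector_mul_assoc matrix_mul_assoc[symmetric])
  have Psym: "transpose P = P" by (simp add: P_def Q'_sym)
  have BB: "a \<bullet> (transpose B *v b) = (B *v a) \<bullet> b" for a b
    by (simp add: inner_matrix_vector_left)
  have UWw: "U \<bullet> (W *v w) = w \<bullet> (W *v U)"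
    using inner_matrix_vector_left[of W U w] pos_defD(1)[OF W(1)] by (simp add: inner_commute)
  have PAB: "(A *v x) \<bullet> (P *v (B *v w)) = (B *v w) \<bullet> (P *v (A *v x))"
    using inner_matrix_vector_left[of P "A *v x" "B *v w"] Psym by (simp add: inner_commute)
  have Fx: "F *v x = A *v x - B *v U"
    by (simp add: F U_def P_def algebra_simps matrix_vector_mul_assoc matrix_mul_assoc[symmetric])
  have "x \<bullet> (matrix_inv Q *v x) = (A *v x) \<bullet> (P *v (F *v x))"
    unfolding riccati_backward
    by (simp add: inner_matrix_vector_left matrix_vector_mul_assoc matrix_mul_assoc P_def)
  also have "\<dots> = (A *v x) \<bullet> (P *v (A *v x)) - U \<bullet> (W *v U)"
    using inner_matrix_vector_left[of P "A *v x" "B *v U"] Psym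
    by (simp add: Fx WU BB algebra_simps inner_diff_right inner_commute)
  finally have Qx: "x \<bullet> (matrix_inv Q *v x) = (A *v x) \<bullet> (P *v (A *v x)) - U \<bullet> (W *v U)" .
  have "v = w + U" by (simp add: v_def U_def P_def)
  then have "v \<bullet> (W *v v) = w \<bullet> (W *v w) + 2 * (w \<bullet> (W *v U)) + U \<bullet> (W *v U)"
    using UWw by (simp add: algebra_simps inner_add_left inner_add_right)
  also have "w \<bullet> (W *v w) = w \<bullet> w + (B *v w) \<bullet> (P *v (B *v w))"
    by (simp add: Ww inner_add_right BB)
  also have "w \<bullet> (W *v U) = (B *v w) \<bullet> (P *v (A *v x))"
    by (simp add: WU BB)
  finally show ?thesis
    using PAB by (simp add: Qx P_def[symmetric] algebra_simps inner_add_left inner_add_right)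
qed

end

text \<open>Everything is written through C = G^(1/2), D = G^(-1/2), R = S0^(1/2) and J. Then K =
  G^-1 - Q^-1 is congruent to J, which gives its sign, and the last claim reduces to J^2 + J = R SN
  R.\<close>

lemma bridge_initial_matrix:
  fixes G \<Sigma>0 Y S0 SN Q :: "real^'n^'n"
  assumes G: "pos_def G" and \<Sigma>0: "pos_def \<Sigma>0" and Y: "pos_def Y"
    and S0: "S0 = inv_sqrt G ** \<Sigma>0 ** inv_sqrt G"
    and SN: "SN = inv_sqrt G ** Y ** inv_sqrt G"
    and F: "invertible (Fmat S0 SN)"
    and Q: "Q = psd_sqrt G ** psd_sqrt S0 ** matrix_inv (Fmat S0 SN) ** psd_sqrt S0 ** psd_sqrt G"
  shows "invertible Q" "transpose Q = Q" "pos_def (matrix_inv G - matrix_inv Q)"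
    "(Q - G) ** (matrix_inv Q ** \<Sigma>0 ** matrix_inv Q - matrix_inv Q) ** (Q - G) + (Q - G) = Y"
proof -
  define C where "C = psd_sqrt G"
  define D where "D = inv_sqrt G"
  note C = psd_sqrt_pos_def[OF G, folded C_def] and D = inv_sqrt_pos_def[OF G, folded C_def D_def]
  have Dinv: "invertible D" by (rule pos_def_invertible[OF D(1)])
  have pos: "pos_def S0" "pos_def SN"
    using pos_def_congruence[OF \<Sigma>0 Dinv] pos_def_congruence[OF Y Dinv] pos_defD(1)[OF D(1)]
    by (simp_all add: S0 SN D_def)
  define R where "R = psd_sqrt S0"
  note R = psd_sqrt_pos_def[OF pos(1), folded R_def]
  define Ri where "Ri = matrix_inv R"
  have Rinv: "invertible R" by (rule pos_def_invertible[OF R(1)])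
  have Ri: "R ** Ri = mat 1" "Ri ** R = mat 1" "pos_def Ri"
    using matrix_inv_mult[OF Rinv] pos_def_matrix_inv[OF R(1)] by (simp_all add: Ri_def)
  define E where "E = R ** SN ** R"
  have E: "pos_def E"
    using pos_def_congruence[OF pos(2) Rinv] pos_defD(1)[OF R(1)] by (simp add: E_def)
  have E4: "pos_def (E + (1/4) *\<^sub>R mat 1)"
    by (intro pos_def_add_semidef E pos_def_imp_semidef pos_def_scaleR pos_def_mat_1) simp
  define T where "T = psd_sqrt (E + (1/4) *\<^sub>R mat 1)"
  note T = psd_sqrt_pos_def[OF E4, folded T_def]
  define J where "J = T - (1/2) *\<^sub>R mat 1"
  have TT: "T = J + (1/2) *\<^sub>R mat 1" by (simp add: J_def)
  have "J ** J + J + (1/4) *\<^sub>R mat 1 = T ** T"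
  proof -
    have "T ** T = J ** J + ((1/2) *\<^sub>R J + (1/2) *\<^sub>R J) + (1/4) *\<^sub>R mat 1"
      unfolding TT by (simp add: matrix_ring_simps matrix_scalar_ac scalar_matrix_assoc[symmetric])
        (simp add: vec_eq_iff field_simps)
    then show ?thesis by (simp add: scaleR_half_double)
  qed
  then have JJ: "J ** J + J = E" using T(2) by simp
  have T2: "pos_def (T + (1/2) *\<^sub>R mat 1)"
    by (intro pos_def_add_semidef T pos_def_imp_semidef pos_def_scaleR pos_def_mat_1) simp
  \<comment> \<open>L^2 = J + 1, so L J L = (J + 1)^2 - (J + 1) = J^2 + J = E. Thus J is congruent
    to E and positive definite, without any diagonalisation.\<close>
  obtain L where L: "pos_def L" "L ** L = T + (1/2) *\<^sub>R mat 1"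
    using pos_def_root_exists[OF T2] .
  have LJ: "L ** L = J + mat 1"
    unfolding L(2) TT add.assoc scaleR_add_left[symmetric] by simp
  have LJL: "L ** J ** L = E"
  proof -
    have "L ** J ** L = L ** (L ** L - mat 1) ** L" by (simp add: LJ)
    also have "\<dots> = (L ** L) ** (L ** L) - L ** L" by (simp add: matrix_ring_simps)
    also have "\<dots> = J ** J + J" by (simp add: LJ matrix_ring_simps)
    finally show ?thesis by (simp add: JJ)
  qed
  have J: "pos_def J"
  proof -
    note Linv = pos_def_invertible[OF L(1)]
    have "transpose (matrix_inv L) ** E ** matrix_inv L = J"
      using matrix_inv_transpose[OF Linv] pos_defD(1)[OF L(1)]
      by (simp add: LJL[symmetric] matrix_mul_assoc[symmetric] matrix_inv_cancel matrix_inv_mult Linv)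
    then show ?thesis
      using pos_def_congruence[OF E invertible_matrix_inv[OF Linv]] by simp
  qed
  have Feq: "Fmat S0 SN = R ** R - J"
    by (simp add: Fmat_def R(2)[folded R_def] J_def T_def E_def R_def psd_sqrt_pos_def(2)[OF pos(1)])
  define Fi where "Fi = matrix_inv (R ** R - J)"
  have Finv: "invertible (R ** R - J)" using F by (simp add: Feq)
  have FFi: "(R ** R - J) ** Fi = mat 1" "Fi ** (R ** R - J) = mat 1"
    using matrix_inv_mult[OF Finv] by (simp_all add: Fi_def)
  have assoc1: "X ** (Z ** V) = V" if "X ** Z = mat 1" for X Z V :: "real^'n^'n"
    using that by (simp add: matrix_mul_assoc)
  note canc = D(3,4) assoc1[OF D(3)] assoc1[OF D(4)] Ri(1,2) assoc1[OF Ri(1)] assoc1[OF Ri(2)]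
    FFi assoc1[OF FFi(1)] assoc1[OF FFi(2)]
  have Qeq: "Q = C ** (R ** (Fi ** (R ** C)))"
    by (simp add: Q Feq C_def R_def Fi_def matrix_mul_assoc)
  define Qi where "Qi = D ** (Ri ** ((R ** R - J) ** (Ri ** D)))"
  have QQi: "Q ** Qi = mat 1"
    by (simp add: Qeq Qi_def matrix_mul_assoc[symmetric] canc)
  then show Qinv: "invertible Q" using invertible_right_inverse by blast
  have Qi: "matrix_inv Q = Qi" by (rule matrix_inv_eqI[OF QQi])
  note QQi2 = matrix_inv_mult[OF Qinv, unfolded Qi]
  have Gi: "matrix_inv G = D ** D" using D(2) by simp
  have "transpose Fi = Fi"
    using matrix_inv_transpose[OF Finv] pos_defD(1)[OF R(1)] pos_defD(1)[OF J]
    by (simp add: Fi_def transpose_simps)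
  then show "transpose Q = Q"
    using pos_defD(1)[OF R(1)] pos_defD(1)[OF C(1)]
    by (simp add: Qeq transpose_simps matrix_mul_assoc)
  define K where "K = D ** (Ri ** (J ** (Ri ** D)))"
  have Keq: "matrix_inv G - matrix_inv Q = K"
    by (simp add: Gi Qi Qi_def K_def matrix_ring_simps canc)
  have "K = transpose (Ri ** D) ** J ** (Ri ** D)"
    using pos_defD(1)[OF Ri(3)] pos_defD(1)[OF D(1)] by (simp add: K_def transpose_simps matrix_mul_assoc)
  moreover have "invertible (Ri ** D)"
    by (intro invertible_mult Dinv pos_def_invertible[OF Ri(3)])
  ultimately show "pos_def (matrix_inv G - matrix_inv Q)"
    using pos_def_congruence[OF J] Keq by simp
  have S0R: "\<Sigma>0 = C ** (R ** (R ** C))"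
  proof -
    have "C ** (S0 ** C) = \<Sigma>0"
      by (simp add: S0 D_def[symmetric] matrix_mul_assoc[symmetric] canc)
    then show ?thesis by (simp add: R(2)[symmetric] matrix_mul_assoc)
  qed
  have YE: "Y = C ** (SN ** C)"
    by (simp add: SN D_def[symmetric] matrix_mul_assoc[symmetric] canc)
  have Qi_K: "Qi = D ** D - K" using Keq unfolding Gi Qi by (simp add: algebra_simps)
  \<comment> \<open>The aim is (Q - G) Q^-1 = G K and its mirror image; they turn the left side of
    the last claim into G (K \<Sigma>0 K + K) G.\<close>
  have "(Q - G) ** Qi = mat 1 - G ** Qi" "Qi ** (Q - G) = mat 1 - Qi ** G"
    by (simp_all add: matrix_sub_rdistrib matrix_sub_ldistrib QQi2)
  moreover have "G ** Qi = mat 1 - G ** K" "Qi ** G = mat 1 - K ** G"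
    unfolding Qi_K C(2)[symmetric] by (simp_all add: matrix_ring_simps canc)
  ultimately have GK: "(Q - G) ** Qi = G ** K" "Qi ** (Q - G) = K ** G" by simp_all
  have "(Q - G) ** (Qi ** \<Sigma>0 ** Qi - Qi) ** (Q - G) + (Q - G)
    = ((Q - G) ** Qi) ** \<Sigma>0 ** (Qi ** (Q - G)) + ((Q - G) - ((Q - G) ** Qi) ** (Q - G))"
    by (simp add: matrix_mul_assoc matrix_sub_ldistrib matrix_sub_rdistrib)
  also have "(Q - G) - ((Q - G) ** Qi) ** (Q - G) = ((Q - G) ** Qi) ** G"
    by (simp add: matrix_ring_simps QQi2)
  also have "((Q - G) ** Qi) ** \<Sigma>0 ** (Qi ** (Q - G)) + ((Q - G) ** Qi) ** G
     = C ** (C ** (K ** \<Sigma>0 ** K + K) ** C) ** C"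
    unfolding GK by (simp add: matrix_ring_simps C(2)[symmetric])
  also have "C ** (K ** \<Sigma>0 ** K + K) ** C = Ri ** (J ** J + J) ** Ri"
    by (simp add: matrix_ring_simps K_def S0R canc)
  also have "\<dots> = SN" by (simp add: JJ E_def matrix_mul_assoc[symmetric] canc)
  finally show "(Q - G) ** (matrix_inv Q ** \<Sigma>0 ** matrix_inv Q - matrix_inv Q) ** (Q - G) + (Q - G) = Y"
    by (simp add: Qi YE matrix_mul_assoc)
qed

subsection \<open>Linear change of variables for Lebesgue measure\<close>

text \<open>Fubini along e: on every line parallel to e the displacement is constant, so the map is
  a translation there. The slicing comes from the definition of Lebesgue measure as a product over
  the basis.\<close>

lemma nn_integral_lborel_shear:
  fixes f :: "'a::euclidean_space \<Rightarrow> ennreal" and h :: "'a \<Rightarrow> real"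
  assumes [measurable]: "f \<in> borel_measurable borel" "h \<in> borel_measurable borel"
    and e: "e \<in> Basis" and h: "\<And>x t. h (x + t *\<^sub>R e) = h x"
  shows "(\<integral>\<^sup>+x. f (x + h x *\<^sub>R e) \<partial>lborel) = (\<integral>\<^sup>+x. f x \<partial>lborel)"
proof -
  interpret product_sigma_finite "\<lambda>_::'a. lborel :: real measure" ..
  define J where "J = (Basis :: 'a set) - {e}"
  have J: "finite J" "e \<notin> J" "insert e J = Basis" using e by (auto simp: J_def)
  have slice: "(\<integral>\<^sup>+x. g x \<partial>lborel) =
      (\<integral>\<^sup>+y. (\<integral>\<^sup>+t. g ((\<Sum>b\<in>J. y b *\<^sub>R b) + t *\<^sub>R e) \<partial>lborel) \<partial>PiM J (\<lambda>_. lborel))"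
    if [measurable]: "g \<in> borel_measurable borel" for g :: "'a \<Rightarrow> ennreal"
  proof -
    have "(\<integral>\<^sup>+x. g x \<partial>lborel) =
        (\<integral>\<^sup>+y. g (\<Sum>b\<in>Basis. y b *\<^sub>R b) \<partial>PiM (insert e J) (\<lambda>_. lborel))"
      unfolding lborel_def[where 'a='a] J(3) lborel_eq_real by (subst nn_integral_distr) simp_all
    also have "\<dots> = (\<integral>\<^sup>+y. (\<integral>\<^sup>+t. g (\<Sum>b\<in>Basis. (y(e := t)) b *\<^sub>R b) \<partial>lborel)
        \<partial>PiM J (\<lambda>_. lborel))"
      by (rule product_nn_integral_insert[OF J(1,2)]) (simp add: J(3))
    moreover have "(\<Sum>b\<in>Basis. (y(e := t)) b *\<^sub>R b) = (\<Sum>b\<in>J. y b *\<^sub>R b) + t *\<^sub>R e" for y t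
    proof -
      have "(\<Sum>b\<in>Basis. (y(e := t)) b *\<^sub>R b) = t *\<^sub>R e + (\<Sum>b\<in>J. (y(e := t)) b *\<^sub>R b)"
        using J by (simp add: J(3)[symmetric])
      also have "(\<Sum>b\<in>J. (y(e := t)) b *\<^sub>R b) = (\<Sum>b\<in>J. y b *\<^sub>R b)"
        using J(2) by (intro sum.cong) auto
      finally show ?thesis by simp
    qed
    ultimately show ?thesis by (simp only:)
  qed
  have "(\<integral>\<^sup>+t. f (z + t *\<^sub>R e + h (z + t *\<^sub>R e) *\<^sub>R e) \<partial>lborel) = (\<integral>\<^sup>+t. f (z + t *\<^sub>R e) \<partial>lborel)" for z
    using nn_integral_real_affine[of "\<lambda>t. f (z + t *\<^sub>R e)" 1 "h z"]
    by (simp add: h algebra_simps)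
  then show ?thesis by (simp add: slice)
qed

definition shear :: "'n \<Rightarrow> 'n \<Rightarrow> real \<Rightarrow> real^'n \<Rightarrow> real^'n" where
  "shear m n c x = (\<chi> i. if i = m then x $ m + c * x $ n else x $ i)"

lemma shear_alt: "shear m n c x = x + (c * x $ n) *\<^sub>R axis m 1"
  by (auto simp: shear_def vec_eq_iff axis_def)

lemma measurable_shear[measurable]: "shear m n c \<in> borel_measurable borel"
  unfolding shear_alt[abs_def] by (intro borel_measurable_continuous_onI continuous_intros)

lemma Basis_cart: "(Basis :: (real^'n) set) = range (\<lambda>i. axis i 1)"
  by (auto simp: Basis_vec_def)

text \<open>The displacement c * x $ n is constant along axis m because m and n differ.\<close>

lemma nn_integral_shear:
  fixes f :: "real^'n \<Rightarrow> ennreal"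
  assumes "f \<in> borel_measurable borel" "m \<noteq> n"
  shows "(\<integral>\<^sup>+x. f (shear m n c x) \<partial>lborel) = (\<integral>\<^sup>+x. f x \<partial>lborel)"
proof -
  have "(\<lambda>x :: real^'n. c * x $ n) \<in> borel_measurable borel"
    by (intro borel_measurable_continuous_onI continuous_intros)
  then show ?thesis unfolding shear_alt
    using assms by (intro nn_integral_lborel_shear) (auto simp: Basis_cart axis_def)
qed

lemma nn_integral_diagonal:
  fixes U :: "real^'n^'n"
  assumes U: "\<And>i j. i \<noteq> j \<Longrightarrow> U$i$j = 0" and nz: "det U \<noteq> 0" and [measurable]: "f \<in> borel_measurable borel"
  shows "ennreal \<bar>det U\<bar> * (\<integral>\<^sup>+x. f (U *v x) \<partial>lborel) = (\<integral>\<^sup>+x. f x \<partial>lborel)"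
proof -
  have det: "det U = (\<Prod>i\<in>UNIV. U$i$i)" by (rule det_diagonal) (rule U)
  \<comment> \<open>For diagonal U this reads off the diagonal entry belonging to a basis vector,
    the indexing that \<open>lborel_affine_euclidean\<close> expects.\<close>
  define c where "c b = b \<bullet> (U *v b)" for b
  have c: "c (axis i 1) = U$i$i" for i
    by (simp add: c_def inner_axis' matrix_vector_mult_basis column_def)
  have inj: "inj (\<lambda>i. axis i 1 :: real^'n)" by (auto simp: inj_on_def axis_eq_axis)
  have prod: "(\<Prod>b\<in>Basis. \<bar>c b\<bar>) = \<bar>det U\<bar>"
    by (simp add: Basis_cart prod.reindex[OF inj] c det abs_prod)
  have cnz: "c b \<noteq> 0" if "b \<in> Basis" for b
    using nz that by (auto simp: Basis_cart c det)
  have T: "U *v x = 0 + (\<Sum>b\<in>Basis. (c b * (x \<bullet> b)) *\<^sub>R b)" for x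
  proof -
    have "(U *v x) $ i = U$i$i * x$i" for i
    proof -
      have "(\<Sum>j\<in>UNIV. U$i$j * x$j) = (\<Sum>j\<in>UNIV. if j = i then U$i$i * x$i else 0)"
        by (rule sum.cong) (auto simp: U)
      then show ?thesis by (simp add: matrix_vector_mult_def)
    qed
    moreover have "(0 + (\<Sum>b\<in>Basis. (c b * (x \<bullet> b)) *\<^sub>R b)) $ i = U$i$i * x$i" for i
      by (simp add: Basis_cart sum.reindex[OF inj] c inner_axis) (simp add: axis_def if_distrib cong: if_cong)
    ultimately show ?thesis by (simp add: vec_eq_iff)
  qed
  have [measurable]: "(\<lambda>x. U *v x) \<in> borel_measurable borel"
    by (intro borel_measurable_continuous_onI linear_continuous_on matrix_vector_mul_bounded_linear)
  have "lborel = density (distr lborel borel (\<lambda>x. U *v x)) (\<lambda>_. ennreal \<bar>det U\<bar>)"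
    using lborel_affine_euclidean[of c 0, OF cnz] by (simp only: T[symmetric] prod)
  then have "(\<integral>\<^sup>+x. f x \<partial>lborel) =
      (\<integral>\<^sup>+x. f x \<partial>density (distr lborel borel (\<lambda>x. U *v x)) (\<lambda>_. ennreal \<bar>det U\<bar>))"
    by simp
  also have "\<dots> = ennreal \<bar>det U\<bar> * (\<integral>\<^sup>+x. f (U *v x) \<partial>lborel)"
    by (simp add: nn_integral_density nn_integral_distr nn_integral_cmult)
  finally show ?thesis by simp
qed

lemma measurable_matrix_vector_mult[measurable]:
  "(\<lambda>x. U *v x) \<in> borel_measurable borel" for U :: "real^'n^'m"
  by (intro borel_measurable_continuous_onI linear_continuous_on matrix_vector_mul_bounded_linear)

lemma measurable_matrix_vector_mult_comp[measurable (raw)]: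
  "(\<lambda>x. U *v f x) \<in> borel_measurable M" if "f \<in> borel_measurable M" for U :: "real^'n^'m"
  using measurable_compose[OF that measurable_matrix_vector_mult] .

text \<open>In coordinates m and n a swap is three shears and a sign change: (a, b), (a + b, b), (a
  + b, -a), (b, -a), (b, a).\<close>

lemma nn_integral_swap:
  assumes mn: "m \<noteq> n" and [measurable]: "f \<in> borel_measurable borel"
  shows "(\<integral>\<^sup>+x. f (\<chi> i. x $ Transposition.transpose m n i) \<partial>lborel) = (\<integral>\<^sup>+(x :: real^'n). f x \<partial>lborel)"
proof -
  define R where "R = ((\<chi> i j. if i = j then if i = n then -1 else 1 else 0) :: real^'n^'n)"
  have R: "R *v x = (\<chi> i. if i = n then - x$i else x$i)" for x
  proof -
    have "(\<Sum>j\<in>UNIV. (if i = j then if i = n then -1 else 1 else 0) * x$j) =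
      (\<Sum>j\<in>UNIV. if j = i then if i = n then - x$i else x$i else 0)" for i
      by (intro sum.cong) auto
    then show ?thesis by (simp add: R_def matrix_vector_mult_def vec_eq_iff)
  qed
  have "det R = (\<Prod>i\<in>UNIV. R$i$i)" by (rule det_diagonal) (simp add: R_def)
  then have "\<bar>det R\<bar> = (\<Prod>i\<in>UNIV. \<bar>R$i$i\<bar>)" by (simp add: abs_prod)
  also have "\<dots> = 1" by (rule prod.neutral) (simp add: R_def)
  finally have detR: "\<bar>det R\<bar> = 1" .
  have "(\<chi> i. x $ Transposition.transpose m n i) = R *v shear m n 1 (shear n m (-1) (shear m n 1 x))" for x :: "real^'n"
    using mn by (auto simp: R shear_def vec_eq_iff Transposition.transpose_def)
  then have "(\<integral>\<^sup>+x. f (\<chi> i. x $ Transposition.transpose m n i) \<partial>lborel) =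
      (\<integral>\<^sup>+x. f (R *v shear m n 1 (shear n m (-1) (shear m n 1 x))) \<partial>lborel)"
    by simp
  also have "\<dots> = (\<integral>\<^sup>+x. f (R *v shear m n 1 (shear n m (-1) x)) \<partial>lborel)"
    using mn by (intro nn_integral_shear[of "\<lambda>x. f (R *v shear m n 1 (shear n m (-1) x))"]) simp_all
  also have "\<dots> = (\<integral>\<^sup>+x. f (R *v shear m n 1 x) \<partial>lborel)"
    using mn by (intro nn_integral_shear[of "\<lambda>x. f (R *v shear m n 1 x)"]) simp_all
  also have "\<dots> = (\<integral>\<^sup>+x. f (R *v x) \<partial>lborel)"
    using mn by (intro nn_integral_shear[of "\<lambda>x. f (R *v x)"]) simp_all
  also have "\<dots> = (\<integral>\<^sup>+x. f x \<partial>lborel)"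
    using nn_integral_diagonal[of R f] detR by (auto simp: R_def)
  finally show ?thesis .
qed

text \<open>The library's \<open>measure_linear_image\<close> is restricted to well-ordered index types.\<close>

lemma nn_integral_lborel_matrix:
  fixes U :: "real^'n^'n"
  assumes "invertible U" "f \<in> borel_measurable borel"
  shows "ennreal \<bar>det U\<bar> * (\<integral>\<^sup>+x. f (U *v x) \<partial>lborel) = (\<integral>\<^sup>+x. f x \<partial>lborel)"
proof -
  \<comment> \<open>The premise on the determinant makes the zero-row case vacuous; the quantifier
    over f lets the product case use the hypothesis for B at f composed with A.\<close>
  have "det U \<noteq> 0 \<longrightarrow> (\<forall>f\<in>borel_measurable borel.
    ennreal \<bar>det U\<bar> * (\<integral>\<^sup>+x. f (U *v x) \<partial>lborel) = (\<integral>\<^sup>+x. f x \<partial>lborel))" (is "?P U")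
  proof (induction U rule: induct_matrix_elementary)
    fix A B :: "real^'n^'n"
    assume A: "?P A" and B: "?P B"
    show "?P (A ** B)"
    proof (intro impI ballI)
      fix f :: "real^'n \<Rightarrow> ennreal"
      assume nz: "det (A ** B) \<noteq> 0" and f[measurable]: "f \<in> borel_measurable borel"
      have "ennreal \<bar>det (A ** B)\<bar> * (\<integral>\<^sup>+x. f ((A ** B) *v x) \<partial>lborel) =
        ennreal \<bar>det A\<bar> * (ennreal \<bar>det B\<bar> * (\<integral>\<^sup>+x. f (A *v (B *v x)) \<partial>lborel))"
        by (simp add: det_mul abs_mult ennreal_mult matrix_vector_mul_assoc mult.assoc)
      also have "ennreal \<bar>det B\<bar> * (\<integral>\<^sup>+x. f (A *v (B *v x)) \<partial>lborel) = (\<integral>\<^sup>+x. f (A *v x) \<partial>lborel)"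
        using B[rule_format, of "\<lambda>x. f (A *v x)"] nz by (simp add: det_mul)
      also have "ennreal \<bar>det A\<bar> * \<dots> = (\<integral>\<^sup>+x. f x \<partial>lborel)"
        using A[rule_format, of f] nz by (simp add: det_mul)
      finally show "ennreal \<bar>det (A ** B)\<bar> * (\<integral>\<^sup>+x. f ((A ** B) *v x) \<partial>lborel) = (\<integral>\<^sup>+x. f x \<partial>lborel)" .
    qed
  next
    fix A :: "real^'n^'n" and i assume "row i A = 0"
    then show "?P A" by (metis det_zero_row(2))
  next
    fix A :: "real^'n^'n" assume "\<And>i j. i \<noteq> j \<Longrightarrow> A $ i $ j = 0"
    then show "?P A" using nn_integral_diagonal[of A] by blast
  next
    fix m n :: 'n assume mn: "m \<noteq> n"
    let ?S = "(\<chi> i j. mat 1 $ i $ Transposition.transpose m n j) :: real^'n^'n"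
    have "?S *v x = (\<chi> i. x $ Transposition.transpose m n i)" for x
    proof -
      have "(\<Sum>j\<in>UNIV. (if i = Transposition.transpose m n j then 1 else 0) * x$j) =
        (\<Sum>j\<in>UNIV. if j = Transposition.transpose m n i then x $ Transposition.transpose m n i else 0)" for i
        by (intro sum.cong) (auto simp: transpose_eq_iff)
      then show ?thesis by (simp add: matrix_vector_mult_def vec_eq_iff mat_def)
    qed
    moreover have "\<bar>det ?S\<bar> = 1"
      by (simp add: det_permute_columns permutes_swap_id sign_swap_id abs_mult mn)
    ultimately show "?P ?S" using nn_integral_swap[OF mn] by simp
  next
    fix m n :: 'n and c :: real assume mn: "m \<noteq> n"
    let ?S = "(\<chi> i j. if i = m \<and> j = n then c else of_bool (i = j)) :: real^'n^'n"
    have "?S = (\<chi> k. if k = m then row m (mat 1) + c *s row n (mat 1) else row k (mat 1))"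
      using mn by (auto simp: vec_eq_iff row_def mat_def)
    then have "det ?S = 1"
      using det_row_operation[OF mn, of "mat 1 :: real^'n^'n" c] by simp
    moreover have "?S *v x = shear m n c x" for x
    proof -
      have "(?S *v x) $ i = shear m n c x $ i" for i
      proof -
        have "(\<Sum>j\<in>UNIV. (if i = m \<and> j = n then c else of_bool (i = j)) * x$j) =
            (\<Sum>j\<in>UNIV. (if j = i then x$i else 0) + (if j = n then if i = m then c * x$n else 0 else 0))"
          using mn by (intro sum.cong) auto
        then show ?thesis by (simp add: sum.distrib shear_def matrix_vector_mult_def)
      qed
      then show ?thesis by (simp add: vec_eq_iff)
    qed
    ultimately show "?P ?S" using nn_integral_shear[OF _ mn] by simp
  qed
  then show ?thesis using assms by (simp add: invertible_det_nz)
qed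

lemma nn_integral_lborel_affine:
  fixes U :: "real^'n^'n"
  assumes "invertible U" and [measurable]: "f \<in> borel_measurable borel"
  shows "ennreal \<bar>det U\<bar> * (\<integral>\<^sup>+x. f (a + U *v x) \<partial>lborel) = (\<integral>\<^sup>+x. f x \<partial>lborel)"
proof -
  have "(\<integral>\<^sup>+x. f x \<partial>lborel) = (\<integral>\<^sup>+x. f (a + x) \<partial>lborel)"
    by (subst lborel_distr_plus[of a, symmetric]) (simp add: nn_integral_distr)
  then show ?thesis
    using nn_integral_lborel_matrix[OF assms(1), of "\<lambda>x. f (a + x)"] by simp
qed

subsection \<open>Gaussian measures\<close>

definition gaussian_density :: "real^'n \<Rightarrow> real^'n^'n \<Rightarrow> real^'n \<Rightarrow> real" where
  "gaussian_density \<mu> \<Sigma> x =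
    exp (- ((x - \<mu>) \<bullet> (matrix_inv \<Sigma> *v (x - \<mu>))) / 2) / sqrt ((2 * pi) ^ CARD('n) * det \<Sigma>)"

lemma gaussian_eq: "gaussian \<mu> \<Sigma> = density lborel (\<lambda>x. ennreal (gaussian_density \<mu> \<Sigma> x))"
  by (simp add: gaussian_def gaussian_density_def)

lemma measurable_gaussian_density[measurable]:
  "gaussian_density \<mu> \<Sigma> \<in> borel_measurable borel"
  unfolding gaussian_density_def[abs_def] by measurable

lemma sets_gaussian[simp, measurable_cong]: "sets (gaussian \<mu> \<Sigma>) = sets borel"
  by (simp add: gaussian_def)

lemma space_gaussian[simp]: "space (gaussian \<mu> \<Sigma>) = UNIV"
  by (simp add: gaussian_def)

lemma nn_integral_gaussian:
  assumes [measurable]: "f \<in> borel_measurable borel"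
  shows "(\<integral>\<^sup>+x. f x \<partial>gaussian \<mu> \<Sigma>) = (\<integral>\<^sup>+x. ennreal (gaussian_density \<mu> \<Sigma> x) * f x \<partial>lborel)"
  unfolding gaussian_eq by (subst nn_integral_density) auto

lemma gaussian_normalization_pos:
  "pos_def \<Sigma> \<Longrightarrow> 0 < sqrt ((2 * pi) ^ CARD('n) * det \<Sigma>)" for \<Sigma> :: "real^'n^'n"
  by (intro real_sqrt_gt_zero mult_pos_pos det_pos_def zero_less_power) simp_all

lemma gaussian_density_pos: "pos_def \<Sigma> \<Longrightarrow> 0 < gaussian_density \<mu> \<Sigma> x"
  unfolding gaussian_density_def using gaussian_normalization_pos[of \<Sigma>] by (intro divide_pos_pos) auto

text \<open>The determinant of U \<Sigma> U^T is (det U)^2 det \<Sigma>, so its root in the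
  normalisation contributes exactly the Jacobian factor.\<close>

lemma gaussian_density_affine:
  fixes U :: "real^'n^'n"
  assumes \<Sigma>: "pos_def \<Sigma>" and U: "invertible U"
  shows "\<bar>det U\<bar> * gaussian_density (a + U *v \<mu>) (U ** \<Sigma> ** transpose U) (a + U *v x) =
    gaussian_density \<mu> \<Sigma> x"
proof -
  note Ut = transpose_invertible[OF U] and \<Sigma>inv = pos_def_invertible[OF \<Sigma>]
  have dU: "det U \<noteq> 0" using U invertible_det_nz by blast
  have inv: "matrix_inv (U ** \<Sigma> ** transpose U) = transpose (matrix_inv U) ** matrix_inv \<Sigma> ** matrix_inv U"
    by (simp add: matrix_inv_matrix_mult invertible_mult U Ut \<Sigma>inv matrix_inv_transpose matrix_mul_assoc)
  have diff: "a + U *v x - (a + U *v \<mu>) = U *v (x - \<mu>)" by (simp add: algebra_simps)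
  have "(U *v y) \<bullet> (matrix_inv (U ** \<Sigma> ** transpose U) *v (U *v y)) = y \<bullet> (matrix_inv \<Sigma> *v y)" for y
    unfolding inv
    by (simp add: matrix_vector_mul_assoc[symmetric] matrix_inv_vector_cancel U)
      (metis U inner_matrix_vector_left matrix_inv_vector_cancel(2) transpose_transpose)
  moreover have "sqrt ((2 * pi) ^ CARD('n) * det (U ** \<Sigma> ** transpose U)) =
      \<bar>det U\<bar> * sqrt ((2 * pi) ^ CARD('n) * det \<Sigma>)"
  proof -
    have "(2 * pi) ^ CARD('n) * det (U ** \<Sigma> ** transpose U) = (det U)\<^sup>2 * ((2 * pi) ^ CARD('n) * det \<Sigma>)"
      by (simp add: det_mul power2_eq_square)
    then show ?thesis by (simp only: real_sqrt_mult real_sqrt_abs)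
  qed
  ultimately show ?thesis
    using dU unfolding gaussian_density_def diff by simp
qed

lemma distr_gaussian_affine:
  fixes U :: "real^'n^'n"
  assumes \<Sigma>: "pos_def \<Sigma>" and U: "invertible U"
  shows "distr (gaussian \<mu> \<Sigma>) borel (\<lambda>x. a + U *v x) = gaussian (a + U *v \<mu>) (U ** \<Sigma> ** transpose U)"
proof (rule measure_eqI)
  fix X assume "X \<in> sets (distr (gaussian \<mu> \<Sigma>) borel (\<lambda>x. a + U *v x))"
  then have [measurable]: "X \<in> sets borel" by simp
  let ?d = "gaussian_density (a + U *v \<mu>) (U ** \<Sigma> ** transpose U)"
  have "emeasure (gaussian (a + U *v \<mu>) (U ** \<Sigma> ** transpose U)) X = (\<integral>\<^sup>+y. ennreal (?d y) * indicator X y \<partial>lborel)"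
    by (simp add: nn_integral_gaussian flip: nn_integral_indicator)
  also have "\<dots> = ennreal \<bar>det U\<bar> * (\<integral>\<^sup>+x. ennreal (?d (a + U *v x)) * indicator X (a + U *v x) \<partial>lborel)"
    by (rule nn_integral_lborel_affine[OF U, symmetric]) measurable
  also have "\<dots> = (\<integral>\<^sup>+x. ennreal (\<bar>det U\<bar> * ?d (a + U *v x)) * indicator X (a + U *v x) \<partial>lborel)"
    by (subst nn_integral_cmult[symmetric]) (auto simp: ennreal_mult' mult.assoc)
  also have "\<dots> = (\<integral>\<^sup>+x. indicator X (a + U *v x) \<partial>gaussian \<mu> \<Sigma>)"
    by (simp add: gaussian_density_affine[OF assms] nn_integral_gaussian)
  also have "\<dots> = (\<integral>\<^sup>+y. indicator X y \<partial>distr (gaussian \<mu> \<Sigma>) borel (\<lambda>x. a + U *v x))"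
    by (subst nn_integral_distr) simp_all
  also have "\<dots> = emeasure (distr (gaussian \<mu> \<Sigma>) borel (\<lambda>x. a + U *v x)) X"
    by (rule nn_integral_indicator) simp
  finally show "emeasure (distr (gaussian \<mu> \<Sigma>) borel (\<lambda>x. a + U *v x)) X =
    emeasure (gaussian (a + U *v \<mu>) (U ** \<Sigma> ** transpose U)) X" ..
qed simp

lemma matrix_inv_mat_1: "matrix_inv (mat 1) = (mat 1 :: real^'n^'n)"
  by (rule matrix_inv_eqI) simp

text \<open>The density factors over the basis into one-dimensional standard normal densities.
  General covariances follow as affine images.\<close>

lemma prob_space_standard_gaussian: "prob_space (gaussian 0 (mat 1 :: real^'n^'n))"
proof
  have card: "card (Basis :: (real^'n) set) = CARD('n)" by simp
  have dens: "gaussian_density 0 (mat 1) x = (\<Prod>b\<in>Basis. std_normal_density (x \<bullet> b))" for x :: "real^'n"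
  proof -
    have "(\<Prod>b\<in>Basis. std_normal_density (x \<bullet> b)) =
        (1 / sqrt (2 * pi)) ^ CARD('n) * exp (\<Sum>b\<in>Basis. - (x \<bullet> b)\<^sup>2 / 2)"
      by (simp only: std_normal_density_def prod.distrib exp_sum[OF finite_Basis] prod_constant card)
    also have "(\<Sum>b\<in>Basis. - (x \<bullet> b)\<^sup>2 / 2) = - (x \<bullet> x) / 2"
      using euclidean_inner[of x x] by (simp add: power2_eq_square sum_negf sum_divide_distrib)
    finally show ?thesis
      by (simp add: gaussian_density_def matrix_inv_mat_1 real_sqrt_power[symmetric] power_divide power_mult_distrib)
  qed
  have one: "(\<integral>\<^sup>+x. ennreal (std_normal_density x) \<partial>lborel) = 1"
    using prob_space.emeasure_space_1[OF prob_space_normal_density[of 1 0]]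
    by (simp add: emeasure_density)
  have "emeasure (gaussian 0 (mat 1)) (space (gaussian 0 (mat 1 :: real^'n^'n))) =
      (\<integral>\<^sup>+(x :: real^'n). (\<Prod>b\<in>Basis. ennreal (std_normal_density (x \<bullet> b))) \<partial>lborel)"
    by (simp add: gaussian_eq emeasure_density dens prod_ennreal)
  also have "\<dots> = 1" by (subst nn_integral_lborel_prod) (simp_all add: one)
  finally show "emeasure (gaussian 0 (mat 1)) (space (gaussian 0 (mat 1 :: real^'n^'n))) = 1" .
qed

lemma gaussian_eq_distr_standard:
  fixes \<Sigma> :: "real^'n^'n"
  assumes "pos_def \<Sigma>"
  shows "gaussian \<mu> \<Sigma> = distr (gaussian 0 (mat 1)) borel (\<lambda>x. \<mu> + psd_sqrt \<Sigma> *v x)"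
proof -
  note R = psd_sqrt_pos_def[OF assms]
  show ?thesis
    using distr_gaussian_affine[OF pos_def_mat_1 pos_def_invertible[OF R(1)], of 0 \<mu>] R(2) pos_defD(1)[OF R(1)]
    by simp
qed

lemma prob_space_gaussian:
  fixes \<Sigma> :: "real^'n^'n"
  assumes "pos_def \<Sigma>"
  shows "prob_space (gaussian \<mu> \<Sigma>)"
  unfolding gaussian_eq_distr_standard[OF assms]
  by (rule prob_space.prob_space_distr[OF prob_space_standard_gaussian]) measurable

text \<open>Total mass one fixes this value; it later evaluates Gaussian integrals whose centre
  depends on a parameter.\<close>

lemma nn_integral_gaussian_kernel:
  fixes \<Sigma> :: "real^'n^'n"
  assumes "pos_def \<Sigma>"
  shows "(\<integral>\<^sup>+x. ennreal (exp (- ((x - \<mu>) \<bullet> (matrix_inv \<Sigma> *v (x - \<mu>))) / 2)) \<partial>lborel) =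
    ennreal (sqrt ((2 * pi) ^ CARD('n) * det \<Sigma>))" (is "?I = ennreal ?c")
proof -
  note c = gaussian_normalization_pos[OF assms]
  have cc: "k * (1 / k) = 1" if "0 < k" for k :: real using that by simp
  have "1 = emeasure (gaussian \<mu> \<Sigma>) (space (gaussian \<mu> \<Sigma>))"
    by (rule prob_space.emeasure_space_1[OF prob_space_gaussian[OF assms], symmetric])
  also have "\<dots> = (\<integral>\<^sup>+x. ennreal (1 / ?c) * ennreal (exp (- ((x - \<mu>) \<bullet> (matrix_inv \<Sigma> *v (x - \<mu>))) / 2)) \<partial>lborel)"
    using c det_pos_def[OF assms]
    by (simp add: gaussian_eq emeasure_density gaussian_density_def flip: ennreal_mult)
  also have "\<dots> = ennreal (1 / ?c) * ?I" by (rule nn_integral_cmult) measurable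
  finally have "1 = ennreal (1 / ?c) * ?I" .
  then have "ennreal ?c = ennreal ?c * (ennreal (1 / ?c) * ?I)" by simp
  also have "\<dots> = ennreal (?c * (1 / ?c)) * ?I" using c by (subst ennreal_mult) (auto simp: mult.assoc)
  also have "?c * (1 / ?c) = 1" by (rule cc[OF c])
  also have "ennreal 1 * ?I = ?I" by simp
  finally show ?thesis by simp
qed

text \<open>Total mass one determines K. In the convolution below this replaces a determinant
  identity for \<Sigma> + B B^T.\<close>

lemma gaussian_eq_if_prob_density:
  fixes \<Sigma> :: "real^'n^'n"
  assumes \<Sigma>: "pos_def \<Sigma>"
    and P: "prob_space (density lborel (\<lambda>x. K * ennreal (exp (- (x \<bullet> (matrix_inv \<Sigma> *v x)) / 2))))"
  shows "density lborel (\<lambda>x. K * ennreal (exp (- (x \<bullet> (matrix_inv \<Sigma> *v x)) / 2))) = gaussian 0 \<Sigma>"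
proof -
  let ?c = "sqrt ((2 * pi) ^ CARD('n) * det \<Sigma>)"
  note c = gaussian_normalization_pos[OF \<Sigma>]
  have "1 = K * ennreal ?c"
    using prob_space.emeasure_space_1[OF P] nn_integral_gaussian_kernel[OF \<Sigma>, of 0]
    by (simp add: emeasure_density nn_integral_cmult)
  then have "ennreal (1 / ?c) = K * (ennreal ?c * ennreal (1 / ?c))" by (simp add: mult.assoc[symmetric])
  also have "ennreal ?c * ennreal (1 / ?c) = 1" using c by (subst ennreal_mult[symmetric]) auto
  finally have K: "K = ennreal (1 / ?c)" by simp
  show ?thesis
    unfolding gaussian_eq
    using c by (intro density_cong) (auto simp: K gaussian_density_def ennreal_mult[symmetric])
qed

text \<open>B w may be degenerate, so the integral runs over w and not over a density of B w.
  Completing the square in w leaves a multiple of the kernel for \<Sigma> + B B^T.\<close>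

lemma nn_integral_gaussian_add:
  fixes \<Sigma> :: "real^'n^'n" and B :: "real^'m^'n"
  assumes \<Sigma>: "pos_def \<Sigma>" and [measurable]: "f \<in> borel_measurable borel"
  shows "(\<integral>\<^sup>+x. (\<integral>\<^sup>+w. f (x + B *v w) \<partial>gaussian 0 (mat 1)) \<partial>gaussian 0 \<Sigma>) =
    (\<integral>\<^sup>+y. f y \<partial>gaussian 0 (\<Sigma> + B ** transpose B))"
proof -
  define N1 where "N1 = gaussian (0 :: real^'m) (mat 1)"
  define N\<Sigma> where "N\<Sigma> = gaussian 0 \<Sigma>"
  define L where "L = \<Sigma> + B ** transpose B"
  have L: "pos_def L" unfolding L_def by (intro pos_def_add_semidef \<Sigma> pos_semidef_gram)
  define V where "V = mat 1 + transpose B ** matrix_inv \<Sigma> ** B"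
  have V: "pos_def V"
    unfolding V_def
    by (intro pos_def_add_semidef pos_def_mat_1 pos_semidef_congruence pos_def_imp_semidef pos_def_matrix_inv \<Sigma>)
  note \<Sigma>inv = pos_def_invertible[OF \<Sigma>] and Linv = pos_def_invertible[OF L] and Vinv = pos_def_invertible[OF V]
  interpret N1: prob_space N1 unfolding N1_def by (rule prob_space_gaussian[OF pos_def_mat_1])
  interpret N\<Sigma>: prob_space N\<Sigma> unfolding N\<Sigma>_def by (rule prob_space_gaussian[OF \<Sigma>])
  interpret P: pair_prob_space N\<Sigma> N1 ..
  have sets [simp, measurable_cong]: "sets N1 = sets borel" "sets N\<Sigma> = sets borel"
    by (simp_all add: N1_def N\<Sigma>_def)
  interpret NL: pair_sigma_finite "lborel :: (real^'n) measure" N1 ..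
  define c1 where "c1 = sqrt ((2 * pi) ^ CARD('m))"
  define c2 where "c2 = sqrt ((2 * pi) ^ CARD('n) * det \<Sigma>)"
  have c: "0 < c1" "0 < c2"
    using gaussian_normalization_pos[OF \<Sigma>] by (simp_all add: c1_def c2_def)
  define K where "K = ennreal (1 / (c1 * c2)) * ennreal (sqrt ((2 * pi) ^ CARD('m) * det (matrix_inv V)))"
  let ?e = "\<lambda>y. ennreal (exp (- (y \<bullet> (matrix_inv L *v y)) / 2))"
  have inner: "(\<integral>\<^sup>+w. ennreal (gaussian_density 0 \<Sigma> (y - B *v w)) \<partial>N1) = K * ?e y" for y
  proof -
    define \<mu> where "\<mu> = (matrix_inv V ** transpose B ** matrix_inv \<Sigma>) *v y"
    have square: "(y - B *v w) \<bullet> (matrix_inv \<Sigma> *v (y - B *v w)) + w \<bullet> w =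
      (w - \<mu>) \<bullet> (V *v (w - \<mu>)) + y \<bullet> (matrix_inv L *v y)" for w
    proof -
      have v: "w + (matrix_inv V ** transpose B ** matrix_inv \<Sigma> ** mat 1) *v (- y) = w - \<mu>"
        by (simp add: \<mu>_def linear_neg[OF matrix_vector_mul_linear])
      \<comment> \<open>The Riccati square with A = 1, Q = L, Q' = \<Sigma> and state -y applies
        because \<Sigma> = L - B B^T.\<close>
      have "w \<bullet> w - (w - \<mu>) \<bullet> (V *v (w - \<mu>)) - (- y) \<bullet> (matrix_inv L *v (- y)) =
        - ((mat 1 *v (- y) + B *v w) \<bullet> (matrix_inv \<Sigma> *v (mat 1 *v (- y) + B *v w)))"
        unfolding v[symmetric]
        by (rule riccati_complete_square[OF _ Linv _ \<Sigma>inv _ V V_def refl])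
          (use pos_defD(1)[OF L] in \<open>simp_all add: L_def pos_def_invertible pos_def_mat_1\<close>)
      moreover have "mat 1 *v (- y) + B *v w = - (y - B *v w)" by simp
      ultimately show ?thesis
        by (simp only: linear_neg[OF matrix_vector_mul_linear] inner_minus_left inner_minus_right minus_minus)
    qed
    have "(\<integral>\<^sup>+w. ennreal (gaussian_density 0 \<Sigma> (y - B *v w)) \<partial>N1) =
      (\<integral>\<^sup>+w. ennreal (gaussian_density 0 (mat 1) w) * ennreal (gaussian_density 0 \<Sigma> (y - B *v w)) \<partial>lborel)"
      unfolding N1_def by (rule nn_integral_gaussian) measurable
    also have "\<dots> = (\<integral>\<^sup>+w. (ennreal (1 / (c1 * c2)) * ?e y) *
        ennreal (exp (- ((w - \<mu>) \<bullet> (V *v (w - \<mu>))) / 2)) \<partial>lborel)"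
    proof (rule nn_integral_cong)
      fix w
      have "gaussian_density 0 (mat 1) w * gaussian_density 0 \<Sigma> (y - B *v w) =
        1 / (c1 * c2) * exp (- ((y - B *v w) \<bullet> (matrix_inv \<Sigma> *v (y - B *v w)) + w \<bullet> w) / 2)"
        unfolding minus_add_distrib add_divide_distrib exp_add c1_def c2_def
        by (simp add: gaussian_density_def matrix_inv_mat_1)
      also have "\<dots> = 1 / (c1 * c2) * exp (- (y \<bullet> (matrix_inv L *v y)) / 2) * exp (- ((w - \<mu>) \<bullet> (V *v (w - \<mu>))) / 2)"
        unfolding square by (simp add: exp_add[symmetric] add_divide_distrib diff_divide_distrib)
      finally have "gaussian_density 0 (mat 1) w * gaussian_density 0 \<Sigma> (y - B *v w) = \<dots>" .
      moreover have "ennreal (gaussian_density 0 (mat 1) w) * ennreal (gaussian_density 0 \<Sigma> (y - B *v w)) =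
        ennreal (gaussian_density 0 (mat 1) w * gaussian_density 0 \<Sigma> (y - B *v w))"
        by (intro ennreal_mult[symmetric] less_imp_le gaussian_density_pos \<Sigma> pos_def_mat_1)
      ultimately show "ennreal (gaussian_density 0 (mat 1) w) * ennreal (gaussian_density 0 \<Sigma> (y - B *v w)) =
        (ennreal (1 / (c1 * c2)) * ?e y) * ennreal (exp (- ((w - \<mu>) \<bullet> (V *v (w - \<mu>))) / 2))"
        using c by (simp add: ennreal_mult[symmetric])
    qed
    also have "\<dots> = (ennreal (1 / (c1 * c2)) * ?e y) *
        (\<integral>\<^sup>+w. ennreal (exp (- ((w - \<mu>) \<bullet> (V *v (w - \<mu>))) / 2)) \<partial>lborel)"
      by (rule nn_integral_cmult) measurable
    also have "(\<integral>\<^sup>+w. ennreal (exp (- ((w - \<mu>) \<bullet> (V *v (w - \<mu>))) / 2)) \<partial>lborel) =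
        ennreal (sqrt ((2 * pi) ^ CARD('m) * det (matrix_inv V)))"
      using nn_integral_gaussian_kernel[OF pos_def_matrix_inv[OF V], of \<mu>]
      by (simp add: matrix_inv_matrix_inv[OF Vinv])
    finally show ?thesis by (simp add: K_def mult_ac)
  qed
  have law: "(\<integral>\<^sup>+x. (\<integral>\<^sup>+w. f (x + B *v w) \<partial>N1) \<partial>N\<Sigma>) = (\<integral>\<^sup>+y. (K * ?e y) * f y \<partial>lborel)"
    if [measurable]: "f \<in> borel_measurable borel" for f :: "real^'n \<Rightarrow> ennreal"
  proof -
    have "(\<integral>\<^sup>+x. (\<integral>\<^sup>+w. f (x + B *v w) \<partial>N1) \<partial>N\<Sigma>) = (\<integral>\<^sup>+w. (\<integral>\<^sup>+x. f (x + B *v w) \<partial>N\<Sigma>) \<partial>N1)"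
      by (rule P.Fubini'[symmetric]) measurable
    also have "\<dots> = (\<integral>\<^sup>+w. (\<integral>\<^sup>+y. ennreal (gaussian_density 0 \<Sigma> (y - B *v w)) * f y \<partial>lborel) \<partial>N1)"
    proof (rule nn_integral_cong)
      fix w
      have "(\<integral>\<^sup>+x. f (x + B *v w) \<partial>N\<Sigma>) =
          (\<integral>\<^sup>+x. ennreal (gaussian_density 0 \<Sigma> x) * f (x + B *v w) \<partial>lborel)"
        unfolding N\<Sigma>_def by (rule nn_integral_gaussian) measurable
      also have "\<dots> = (\<integral>\<^sup>+y. ennreal (gaussian_density 0 \<Sigma> (y - B *v w)) * f y \<partial>lborel)"
        by (subst lborel_distr_plus[of "B *v w", symmetric], subst nn_integral_distr)
          (simp_all add: add.commute)
      finally show "(\<integral>\<^sup>+x. f (x + B *v w) \<partial>N\<Sigma>) =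
        (\<integral>\<^sup>+y. ennreal (gaussian_density 0 \<Sigma> (y - B *v w)) * f y \<partial>lborel)" .
    qed
    also have "\<dots> = (\<integral>\<^sup>+y. (\<integral>\<^sup>+w. ennreal (gaussian_density 0 \<Sigma> (y - B *v w)) * f y \<partial>N1) \<partial>lborel)"
      by (rule NL.Fubini') measurable
    also have "\<dots> = (\<integral>\<^sup>+y. (K * ?e y) * f y \<partial>lborel)"
      by (simp add: nn_integral_multc inner)
    finally show ?thesis .
  qed
  have "prob_space (density lborel (\<lambda>y. K * ?e y))"
  proof
    have "emeasure (density lborel (\<lambda>y. K * ?e y)) (space (density lborel (\<lambda>y. K * ?e y))) =
      (\<integral>\<^sup>+y. (K * ?e y) * 1 \<partial>lborel)"
      by (simp add: emeasure_density)
    also have "\<dots> = (\<integral>\<^sup>+x. (\<integral>\<^sup>+w. 1 \<partial>N1) \<partial>N\<Sigma>)" by (rule law[symmetric]) simp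
    also have "\<dots> = 1" by (simp add: N1.emeasure_space_1 N\<Sigma>.emeasure_space_1)
    finally show "emeasure (density lborel (\<lambda>y. K * ?e y)) (space (density lborel (\<lambda>y. K * ?e y))) = 1" .
  qed
  from gaussian_eq_if_prob_density[OF L this]
  have "(\<integral>\<^sup>+y. f y \<partial>gaussian 0 L) = (\<integral>\<^sup>+y. f y \<partial>density lborel (\<lambda>y. K * ?e y))" by simp
  also have "\<dots> = (\<integral>\<^sup>+y. (K * ?e y) * f y \<partial>lborel)" by (rule nn_integral_density) measurable
  also have "\<dots> = (\<integral>\<^sup>+x. (\<integral>\<^sup>+w. f (x + B *v w) \<partial>N1) \<partial>N\<Sigma>)" by (rule law[symmetric]) measurable
  finally show ?thesis by (simp add: N1_def N\<Sigma>_def L_def)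
qed

lemma nn_integral_gaussian_linear_add:
  fixes A \<Sigma> :: "real^'n^'n" and B :: "real^'m^'n"
  assumes \<Sigma>: "pos_def \<Sigma>" and A: "invertible A" and [measurable]: "f \<in> borel_measurable borel"
  shows "(\<integral>\<^sup>+x. (\<integral>\<^sup>+w. f (A *v x + B *v w) \<partial>gaussian 0 (mat 1)) \<partial>gaussian 0 \<Sigma>) =
    (\<integral>\<^sup>+y. f y \<partial>gaussian 0 (A ** \<Sigma> ** transpose A + B ** transpose B))"
proof -
  interpret N1: prob_space "gaussian (0 :: real^'m) (mat 1)" by (rule prob_space_gaussian[OF pos_def_mat_1])
  have pos: "pos_def (A ** \<Sigma> ** transpose A)"
    using pos_def_congruence[OF \<Sigma> transpose_invertible[OF A]] by simp
  have "(\<integral>\<^sup>+y. f y \<partial>gaussian 0 (A ** \<Sigma> ** transpose A + B ** transpose B)) =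
    (\<integral>\<^sup>+x. (\<integral>\<^sup>+w. f (x + B *v w) \<partial>gaussian 0 (mat 1)) \<partial>distr (gaussian 0 \<Sigma>) borel (\<lambda>x. 0 + A *v x))"
    unfolding distr_gaussian_affine[OF \<Sigma> A]
    using nn_integral_gaussian_add[OF pos, of f B] by simp
  also have "\<dots> = (\<integral>\<^sup>+x. (\<integral>\<^sup>+w. f (A *v x + B *v w) \<partial>gaussian 0 (mat 1)) \<partial>gaussian 0 \<Sigma>)"
    by (subst nn_integral_distr) simp_all
  finally show ?thesis ..
qed

text \<open>The weight is the likelihood ratio of N(m, W^-1) against N(0, I), a discrete Girsanov
  factor.\<close>

lemma nn_integral_gaussian_shift:
  fixes W :: "real^'m^'m"
  assumes W: "pos_def W" and [measurable]: "f \<in> borel_measurable borel"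
  shows "(\<integral>\<^sup>+w. f (m + inv_sqrt W *v w) \<partial>gaussian 0 (mat 1)) =
    (\<integral>\<^sup>+w. ennreal (sqrt (det W) * exp ((w \<bullet> w - (w - m) \<bullet> (W *v (w - m))) / 2)) * f w \<partial>gaussian 0 (mat 1))"
proof -
  note R = inv_sqrt_pos_def[OF W]
  note Winv = pos_def_invertible[OF W] and Wi = pos_def_matrix_inv[OF W]
  have "(\<integral>\<^sup>+w. f (m + inv_sqrt W *v w) \<partial>gaussian 0 (mat 1)) =
      (\<integral>\<^sup>+w. f w \<partial>distr (gaussian 0 (mat 1)) borel (\<lambda>w. m + inv_sqrt W *v w))"
    by (subst nn_integral_distr) simp_all
  also have "\<dots> = (\<integral>\<^sup>+w. f w \<partial>gaussian m (matrix_inv W))"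
    using distr_gaussian_affine[OF pos_def_mat_1 pos_def_invertible[OF R(1)], of 0 m]
    by (simp add: pos_defD(1)[OF R(1)] R(2))
  also have "\<dots> = (\<integral>\<^sup>+w. ennreal (gaussian_density m (matrix_inv W) w) * f w \<partial>lborel)"
    by (rule nn_integral_gaussian) measurable
  also have "\<dots> = (\<integral>\<^sup>+w. ennreal (gaussian_density 0 (mat 1) w) *
      (ennreal (sqrt (det W) * exp ((w \<bullet> w - (w - m) \<bullet> (W *v (w - m))) / 2)) * f w) \<partial>lborel)"
  proof (rule nn_integral_cong)
    fix w
    have "det W * det (matrix_inv W) = 1"
      by (metis Winv det_I det_mul matrix_inv_mult(1))
    then have "det (matrix_inv W) = inverse (det W)" by (metis inverse_unique)
    then have "sqrt ((2 * pi) ^ CARD('m) * det (matrix_inv W)) = sqrt ((2 * pi) ^ CARD('m)) / sqrt (det W)"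
      by (simp only: real_sqrt_mult real_sqrt_inverse divide_inverse)
    then have "gaussian_density m (matrix_inv W) w =
      exp (- ((w - m) \<bullet> (W *v (w - m))) / 2) * sqrt (det W) / sqrt ((2 * pi) ^ CARD('m))"
      by (simp add: gaussian_density_def matrix_inv_matrix_inv[OF Winv])
    also have "- ((w - m) \<bullet> (W *v (w - m))) / 2 = - (w \<bullet> w) / 2 + (w \<bullet> w - (w - m) \<bullet> (W *v (w - m))) / 2"
      by argo
    also have "exp \<dots> * sqrt (det W) / sqrt ((2 * pi) ^ CARD('m)) =
      gaussian_density 0 (mat 1) w * (sqrt (det W) * exp ((w \<bullet> w - (w - m) \<bullet> (W *v (w - m))) / 2))"
      by (simp only: exp_add) (simp add: gaussian_density_def matrix_inv_mat_1)
    finally have "gaussian_density m (matrix_inv W) w =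
      gaussian_density 0 (mat 1) w * (sqrt (det W) * exp ((w \<bullet> w - (w - m) \<bullet> (W *v (w - m))) / 2))" .
    then show "ennreal (gaussian_density m (matrix_inv W) w) * f w = ennreal (gaussian_density 0 (mat 1) w) *
      (ennreal (sqrt (det W) * exp ((w \<bullet> w - (w - m) \<bullet> (W *v (w - m))) / 2)) * f w)"
      using gaussian_density_pos[OF pos_def_mat_1, of 0 w] det_pos_def[OF W]
      by (simp add: ennreal_mult mult.assoc less_imp_le)
  qed
  also have "\<dots> = (\<integral>\<^sup>+w. ennreal (sqrt (det W) * exp ((w \<bullet> w - (w - m) \<bullet> (W *v (w - m))) / 2)) * f w
      \<partial>gaussian 0 (mat 1))"
    by (rule nn_integral_gaussian[symmetric]) measurable
  finally show ?thesis .
qed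

text \<open>Makes the exponent of the likelihood ratio integrable under every law with the
  prescribed endpoint marginals.\<close>

lemma integrable_gaussian_quadratic:
  fixes \<Sigma> P :: "real^'n^'n"
  assumes \<Sigma>: "pos_def \<Sigma>"
  shows "integrable (gaussian 0 \<Sigma>) (\<lambda>x. x \<bullet> (P *v x))"
proof (rule integrableI_bounded)
  show "(\<lambda>x. x \<bullet> (P *v x)) \<in> borel_measurable (gaussian 0 \<Sigma>)" by measurable
  note \<Sigma>inv = pos_def_invertible[OF \<Sigma>]
  obtain m where m: "0 < m" "\<And>x. m * (x \<bullet> x) \<le> x \<bullet> (matrix_inv \<Sigma> *v x)"
    using pos_def_lower_bound[OF pos_def_matrix_inv[OF \<Sigma>]] by blast
  obtain L where L: "0 < L" "\<And>x. norm (P *v x) \<le> norm x * L"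
    using bounded_linear.pos_bounded[OF matrix_vector_mul_bounded_linear[of P]] by blast
  define c where "c = sqrt ((2 * pi) ^ CARD('n) * det \<Sigma>)"
  have c: "0 < c" unfolding c_def by (rule gaussian_normalization_pos[OF \<Sigma>])
  have \<Sigma>2: "pos_def (2 *\<^sub>R \<Sigma>)" by (rule pos_def_scaleR[OF \<Sigma>]) simp
  have inv2: "matrix_inv (2 *\<^sub>R \<Sigma>) = (1/2) *\<^sub>R matrix_inv \<Sigma>"
    by (rule matrix_inv_eqI) (simp add: matrix_scalar_ac scalar_matrix_assoc[symmetric] matrix_inv_mult[OF \<Sigma>inv])
  have bound: "\<bar>x \<bullet> (P *v x)\<bar> * gaussian_density 0 \<Sigma> x \<le>
      4 * L / (m * c) * exp (- (x \<bullet> (matrix_inv (2 *\<^sub>R \<Sigma>) *v x)) / 2)" for x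
  proof -
    define t where "t = x \<bullet> (matrix_inv \<Sigma> *v x)"
    have "\<bar>x \<bullet> (P *v x)\<bar> \<le> norm x * (norm x * L)"
      by (rule order.trans[OF Cauchy_Schwarz_ineq2 mult_left_mono]) (use L in auto)
    also have "\<dots> = L * (x \<bullet> x)" by (simp add: dot_square_norm power2_eq_square)
    also have "\<dots> \<le> L * (t / m)"
      using m L(1) by (intro mult_left_mono) (auto simp: t_def field_simps)
    \<comment> \<open>Quadratic growth is traded for half of the decay exp (- t / 2); what remains,
      exp (- t / 4), is the kernel of covariance 2 \<Sigma>.\<close>
    also have "t \<le> 4 * exp (t / 4)" using exp_ge_add_one_self[of "t / 4"] by linarith
    then have "L * (t / m) \<le> L * (4 * exp (t / 4) / m)"
      using m(1) L(1) by (intro mult_left_mono divide_right_mono) auto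
    finally have "\<bar>x \<bullet> (P *v x)\<bar> * (exp (- t / 2) / c) \<le> L * (4 * exp (t / 4) / m) * (exp (- t / 2) / c)"
      using c by (intro mult_right_mono) auto
    also have "\<dots> = 4 * L / (m * c) * (exp (t / 4) * exp (- t / 2))" by simp
    also have "exp (t / 4) * exp (- t / 2) = exp (- t / 4)" by (simp add: exp_add[symmetric])
    finally show ?thesis
      by (simp add: gaussian_density_def t_def c_def inv2 scaleR_matrix_vector_assoc[symmetric])
  qed
  have "(\<integral>\<^sup>+x. ennreal (norm (x \<bullet> (P *v x))) \<partial>gaussian 0 \<Sigma>) =
      (\<integral>\<^sup>+x. ennreal (gaussian_density 0 \<Sigma> x) * ennreal (norm (x \<bullet> (P *v x))) \<partial>lborel)"
    by (rule nn_integral_gaussian) measurable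
  also have "\<dots> \<le> (\<integral>\<^sup>+x. ennreal (4 * L / (m * c)) *
      ennreal (exp (- (x \<bullet> (matrix_inv (2 *\<^sub>R \<Sigma>) *v x)) / 2)) \<partial>lborel)"
    using bound gaussian_density_pos[OF \<Sigma>] m(1) L(1) c
    by (intro nn_integral_mono)
      (auto simp: ennreal_mult[symmetric] less_imp_le mult.commute intro!: ennreal_leI)
  also have "\<dots> = ennreal (4 * L / (m * c)) * ennreal (sqrt ((2 * pi) ^ CARD('n) * det (2 *\<^sub>R \<Sigma>)))"
    using nn_integral_gaussian_kernel[OF \<Sigma>2, of 0] by (simp add: nn_integral_cmult)
  also have "\<dots> < \<infinity>" by (simp add: ennreal_mult_less_top)
  finally show "(\<integral>\<^sup>+x. ennreal (norm (x \<bullet> (P *v x))) \<partial>gaussian 0 \<Sigma>) < \<infinity>" .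
qed

subsection \<open>Laws of linear Gaussian trajectories\<close>

primrec traj :: "(nat \<Rightarrow> real^'n^'n) \<Rightarrow> (nat \<Rightarrow> real^'m^'n) \<Rightarrow> real^'n \<Rightarrow> (nat \<Rightarrow> real^'m) \<Rightarrow> nat \<Rightarrow> real^'n" where
  "traj A B x w 0 = x"
| "traj A B x w (Suc k) = A k *v traj A B x w k + B k *v w k"

text \<open>A canonical realisation on the product of initial state and noises: it depends only on
  the coefficients, so processes on different probability spaces become comparable, and the horizon
  k is free for induction.\<close>

definition traj_law :: "(nat \<Rightarrow> real^'n^'n) \<Rightarrow> (nat \<Rightarrow> real^'m^'n) \<Rightarrow> real^'n^'n \<Rightarrow> nat \<Rightarrow> (nat \<Rightarrow> real^'n) measure" where
  "traj_law A B \<Sigma> k = distr (gaussian 0 \<Sigma> \<Otimes>\<^sub>M PiM {..<k} (\<lambda>_. gaussian 0 (mat 1))) (path_space k)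
     (\<lambda>(x, w). \<lambda>i\<in>{..k}. traj A B x w i)"

lemma traj_cong: "(\<And>i. i < k \<Longrightarrow> w i = w' i) \<Longrightarrow> traj A B x w k = traj A B x w' k"
  by (induction k) auto

lemma sets_path_space[measurable_cong]: "sets (path_space k) = sets (PiM {..k} (\<lambda>_. borel))"
  by (simp add: path_space_def)

lemma measurable_path_component[measurable (raw)]:
  assumes "i \<le> k"
  shows "(\<lambda>p. p i) \<in> path_space k \<rightarrow>\<^sub>M borel"
  using assms unfolding path_space_def by (intro measurable_component_singleton) simp

lemma sets_noise[measurable_cong]:
  "sets (gaussian 0 \<Sigma> \<Otimes>\<^sub>M PiM J (\<lambda>_. gaussian 0 \<Gamma>)) = sets (borel \<Otimes>\<^sub>M PiM J (\<lambda>_. borel))"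
  by (intro sets_pair_measure_cong sets_PiM_cong) simp_all

lemma measurable_traj:
  fixes A :: "nat \<Rightarrow> real^'n^'n" and B :: "nat \<Rightarrow> real^'m^'n"
  assumes "i \<le> k"
  shows "(\<lambda>p. traj A B (fst p) (snd p) i) \<in> borel_measurable (borel \<Otimes>\<^sub>M PiM {..<k} (\<lambda>_. borel))"
  using assms
proof (induction i)
  case 0
  show ?case by simp
next
  case (Suc i)
  then have [measurable]: "(\<lambda>p. traj A B (fst p) (snd p) i) \<in> borel_measurable (borel \<Otimes>\<^sub>M PiM {..<k} (\<lambda>_. borel))"
    by simp
  have "i \<in> {..<k}" using Suc by simp
  then have [measurable]: "(\<lambda>p :: (real^'n) \<times> (nat \<Rightarrow> real^'m). snd p i) \<in> borel_measurable (borel \<Otimes>\<^sub>M PiM {..<k} (\<lambda>_. borel))"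
    by (rule measurable_compose[OF measurable_snd measurable_component_singleton])
  show ?case unfolding traj.simps by measurable
qed

lemma measurable_traj_path:
  "(\<lambda>(x, w). \<lambda>i\<in>{..k}. traj A B x w i) \<in> gaussian 0 \<Sigma> \<Otimes>\<^sub>M PiM {..<k} (\<lambda>_. gaussian 0 (mat 1)) \<rightarrow>\<^sub>M path_space k"
proof -
  have "(\<lambda>(x, w). \<lambda>i\<in>{..k}. traj A B x w i) \<in> borel \<Otimes>\<^sub>M PiM {..<k} (\<lambda>_. borel) \<rightarrow>\<^sub>M PiM {..k} (\<lambda>_. borel)"
    unfolding case_prod_beta' by (intro measurable_restrict measurable_traj) simp
  then show ?thesis by (subst measurable_cong_sets[OF sets_noise sets_path_space])
qed

lemma measurable_path_extend:
  fixes A :: "real^'n^'n" and B :: "real^'m^'n"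
  assumes [measurable_cong]: "sets N = sets borel"
  shows "(\<lambda>(p, w). p(Suc k := A *v p k + B *v w)) \<in> path_space k \<Otimes>\<^sub>M N \<rightarrow>\<^sub>M path_space (Suc k)"
proof -
  have [measurable]: "(\<lambda>q :: (nat \<Rightarrow> real^'n) \<times> (real^'m). fst q k) \<in> borel_measurable (path_space k \<Otimes>\<^sub>M N)"
    by (rule measurable_compose[OF measurable_fst measurable_path_component]) simp
  have "(\<lambda>q. (fst q)(Suc k := A *v fst q k + B *v snd q)) \<in>
      path_space k \<Otimes>\<^sub>M N \<rightarrow>\<^sub>M PiM {..Suc k} (\<lambda>_. borel)"
    by (rule measurable_fun_upd[where J="{..k}"]) (auto simp: path_space_def[symmetric])
  then show ?thesis by (simp add: case_prod_beta' path_space_def)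
qed

lemma sets_traj_law[simp, measurable_cong]: "sets (traj_law A B \<Sigma> k) = sets (path_space k)"
  by (simp add: traj_law_def)

lemma space_traj_law[simp]: "space (traj_law A B \<Sigma> k) = space (path_space k)"
  by (simp add: traj_law_def)

text \<open>Independence identifies the joint law of \<open>x 0\<close> and the noises with a
  product measure, and the recursion makes the path a fixed measurable image of that pair.\<close>

lemma path_law_eq_traj_law:
  fixes A :: "nat \<Rightarrow> real^'n^'n" and B :: "nat \<Rightarrow> real^'m^'n"
  assumes P: "linear_gaussian_process M N A B \<Sigma> w x" and N: "0 < N"
  shows "path_law M N x = traj_law A B \<Sigma> N"
proof -
  let ?WB = "PiM {..<N} (\<lambda>_. borel) :: (nat \<Rightarrow> real^'m) measure"
  let ?WG = "PiM {..<N} (\<lambda>_. gaussian 0 (mat 1)) :: (nat \<Rightarrow> real^'m) measure"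
  let ?W = "\<lambda>\<omega>. \<lambda>i\<in>{..<N}. w i \<omega>"
  interpret prob_space M using P by (simp add: linear_gaussian_process_def)
  have x0[measurable]: "x 0 \<in> borel_measurable M" and x0_law: "distr M borel (x 0) = gaussian 0 \<Sigma>"
    and wm: "\<And>i. i < N \<Longrightarrow> w i \<in> borel_measurable M"
    and w_law: "\<And>i. i < N \<Longrightarrow> distr M borel (w i) = gaussian 0 (mat 1)"
    and w_ind: "indep_vars (\<lambda>_. borel) w {..<N}"
    and ind: "indep_set {x 0 -` X \<inter> space M | X. X \<in> sets borel} {?W -` X \<inter> space M | X. X \<in> sets ?WB}"
    and step: "\<And>k \<omega>. k < N \<Longrightarrow> \<omega> \<in> space M \<Longrightarrow> x (Suc k) \<omega> = A k *v x k \<omega> + B k *v w k \<omega>"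
    using P by (auto simp: linear_gaussian_process_def)
  have Wm[measurable]: "?W \<in> M \<rightarrow>\<^sub>M ?WB" by (intro measurable_restrict) (simp add: wm)
  \<comment> \<open>\<open>0 < N\<close> provides the nonempty index set that the product criterion
    for independence needs.\<close>
  have "distr M ?WB ?W = PiM {..<N} (\<lambda>i. distr M borel (w i))"
    using indep_vars_iff_distr_eq_PiM'[where I="{..<N}" and M'="\<lambda>_. borel" and X=w] N wm w_ind by auto
  also have "\<dots> = ?WG" by (intro PiM_cong) (simp_all add: w_law)
  finally have W_law: "distr M ?WB ?W = ?WG" .
  have joint: "gaussian 0 \<Sigma> \<Otimes>\<^sub>M ?WG = distr M (borel \<Otimes>\<^sub>M ?WB) (\<lambda>\<omega>. (x 0 \<omega>, ?W \<omega>))"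
    unfolding W_law[symmetric] x0_law[symmetric]
  proof (rule pair_measure_eqI)
    show "sigma_finite_measure (distr M borel (x 0))" "sigma_finite_measure (distr M ?WB ?W)"
      by (intro prob_space_imp_sigma_finite prob_space_distr x0 Wm)+
    show "sets (distr M borel (x 0) \<Otimes>\<^sub>M distr M ?WB ?W) = sets (distr M (borel \<Otimes>\<^sub>M ?WB) (\<lambda>\<omega>. (x 0 \<omega>, ?W \<omega>)))"
      by (simp cong: sets_pair_measure_cong)
    fix X Y assume "X \<in> sets (distr M borel (x 0))" "Y \<in> sets (distr M ?WB ?W)"
    then have [measurable]: "X \<in> sets borel" "Y \<in> sets ?WB" by simp_all
    have "prob ((x 0 -` X \<inter> space M) \<inter> (?W -` Y \<inter> space M)) =
        prob (x 0 -` X \<inter> space M) * prob (?W -` Y \<inter> space M)"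
      by (rule indep_setD[OF ind]) auto
    moreover have "(\<lambda>\<omega>. (x 0 \<omega>, ?W \<omega>)) -` (X \<times> Y) \<inter> space M =
        (x 0 -` X \<inter> space M) \<inter> (?W -` Y \<inter> space M)" by auto
    ultimately show "emeasure (distr M borel (x 0)) X * emeasure (distr M ?WB ?W) Y =
        emeasure (distr M (borel \<Otimes>\<^sub>M ?WB) (\<lambda>\<omega>. (x 0 \<omega>, ?W \<omega>))) (X \<times> Y)"
      by (subst (1 2 3) emeasure_distr) (simp_all add: emeasure_eq_measure ennreal_mult'')
  qed
  have x_traj: "x k \<omega> = traj A B (x 0 \<omega>) (?W \<omega>) k" if "\<omega> \<in> space M" "k \<le> N" for k \<omega>
    using that(2) by (induction k) (simp_all add: step that(1))
  have T: "(\<lambda>(x, w). \<lambda>i\<in>{..N}. traj A B x w i) \<in>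
      distr M (borel \<Otimes>\<^sub>M ?WB) (\<lambda>\<omega>. (x 0 \<omega>, ?W \<omega>)) \<rightarrow>\<^sub>M path_space N"
    using measurable_traj_path[where A=A and B=B and k=N and \<Sigma>=\<Sigma>] by (simp only: joint)
  have "traj_law A B \<Sigma> N = distr M (path_space N) ((\<lambda>(x, w). \<lambda>i\<in>{..N}. traj A B x w i) \<circ> (\<lambda>\<omega>. (x 0 \<omega>, ?W \<omega>)))"
    unfolding traj_law_def joint
    by (rule distr_distr) (use T in \<open>simp_all add: measurable_cong_sets[OF sets_distr refl]\<close>)
  also have "\<dots> = path_law M N x"
    unfolding path_law_def
    by (rule distr_cong) (auto simp: x_traj[symmetric] intro!: restrict_ext)
  finally show ?thesis ..
qed

context
  fixes \<Sigma>0 :: "real^'n^'n"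
  assumes \<Sigma>0: "pos_def \<Sigma>0"
begin

lemma prob_space_traj_law: "prob_space (traj_law A B \<Sigma>0 k)" for A :: "nat \<Rightarrow> real^'n^'n" and B :: "nat \<Rightarrow> real^'m^'n"
proof -
  interpret X: prob_space "gaussian 0 \<Sigma>0" by (rule prob_space_gaussian[OF \<Sigma>0])
  interpret W: product_prob_space "\<lambda>_. gaussian (0 :: real^'m) (mat 1)" "{..<k}"
    by (intro product_prob_spaceI prob_space_standard_gaussian)
  interpret pair_prob_space "gaussian 0 \<Sigma>0" "PiM {..<k} (\<lambda>_. gaussian (0 :: real^'m) (mat 1))" ..
  show ?thesis unfolding traj_law_def by (rule prob_space_distr[OF measurable_traj_path])
qed

lemma distr_traj_law_initial:
  fixes A :: "nat \<Rightarrow> real^'n^'n" and B :: "nat \<Rightarrow> real^'m^'n"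
  shows "distr (traj_law A B \<Sigma>0 k) borel (\<lambda>p. p 0) = gaussian 0 \<Sigma>0"
proof -
  interpret W: product_prob_space "\<lambda>_. gaussian (0 :: real^'m) (mat 1)" "{..<k}"
    by (intro product_prob_spaceI prob_space_standard_gaussian)
  let ?G = "gaussian 0 \<Sigma>0" and ?W = "PiM {..<k} (\<lambda>_. gaussian (0 :: real^'m) (mat 1))"
  have "distr (traj_law A B \<Sigma>0 k) borel (\<lambda>p. p 0) =
      distr (?G \<Otimes>\<^sub>M ?W) borel ((\<lambda>p. p 0) \<circ> (\<lambda>(x, w). \<lambda>i\<in>{..k}. traj A B x w i))"
    unfolding traj_law_def by (rule distr_distr[OF _ measurable_traj_path]) measurable
  also have "\<dots> = distr (?G \<Otimes>\<^sub>M ?W) ?G fst"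
    by (rule distr_cong) auto
  also have "\<dots> = ?G" by (rule W.P.distr_pair_fst)
  finally show ?thesis .
qed

text \<open>The path up to time k ignores the noise \<open>w k\<close>, so that coordinate can be
  integrated separately. Both inductions on the horizon below rest on this disintegration.\<close>

lemma nn_integral_traj_law_Suc:
  fixes A :: "nat \<Rightarrow> real^'n^'n" and B :: "nat \<Rightarrow> real^'m^'n"
  assumes f[measurable]: "f \<in> borel_measurable (path_space (Suc k))"
  shows "(\<integral>\<^sup>+p. f p \<partial>traj_law A B \<Sigma>0 (Suc k)) =
    (\<integral>\<^sup>+p. (\<integral>\<^sup>+w. f (p(Suc k := A k *v p k + B k *v w)) \<partial>gaussian 0 (mat 1)) \<partial>traj_law A B \<Sigma>0 k)"
proof -
  let ?G = "gaussian 0 \<Sigma>0" and ?g = "gaussian (0 :: real^'m) (mat 1)"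
  let ?W = "\<lambda>k. PiM {..<k} (\<lambda>_. gaussian (0 :: real^'m) (mat 1))"
  let ?T = "\<lambda>k x w. \<lambda>i\<in>{..k}. traj A B x w i"
  interpret g: prob_space ?g by (rule prob_space_standard_gaussian)
  interpret W: product_prob_space "\<lambda>_. ?g" "{..<l}" for l
    by (intro product_prob_spaceI prob_space_standard_gaussian)
  have T[measurable]: "(\<lambda>(x, w). ?T l x w) \<in> ?G \<Otimes>\<^sub>M ?W l \<rightarrow>\<^sub>M path_space l" for l
    by (rule measurable_traj_path)
  have upd[measurable]: "(\<lambda>(p, w). p(Suc k := A k *v p k + B k *v w)) \<in> path_space k \<Otimes>\<^sub>M ?g \<rightarrow>\<^sub>M path_space (Suc k)"
    by (rule measurable_path_extend) simp
  have integ: "(\<integral>\<^sup>+p. h p \<partial>traj_law A B \<Sigma>0 l) = (\<integral>\<^sup>+x. (\<integral>\<^sup>+w. h (?T l x w) \<partial>?W l) \<partial>?G)"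
    if [measurable]: "h \<in> borel_measurable (path_space l)" for h l
  proof -
    have "(\<integral>\<^sup>+p. h p \<partial>traj_law A B \<Sigma>0 l) = (\<integral>\<^sup>+z. h (case z of (x, w) \<Rightarrow> ?T l x w) \<partial>(?G \<Otimes>\<^sub>M ?W l))"
      unfolding traj_law_def by (rule nn_integral_distr[OF T]) measurable
    also have "\<dots> = (\<integral>\<^sup>+x. (\<integral>\<^sup>+w. h (case (x, w) of (x, w) \<Rightarrow> ?T l x w) \<partial>?W l) \<partial>?G)"
      by (rule W.P.nn_integral_fst[symmetric]) measurable
    finally show ?thesis by simp
  qed
  have "(\<integral>\<^sup>+p. f p \<partial>traj_law A B \<Sigma>0 (Suc k)) = (\<integral>\<^sup>+x. (\<integral>\<^sup>+w. f (?T (Suc k) x w) \<partial>?W (Suc k)) \<partial>?G)"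
    by (rule integ) measurable
  also have "\<dots> = (\<integral>\<^sup>+x. (\<integral>\<^sup>+w. (\<integral>\<^sup>+v. f ((?T k x w)(Suc k := A k *v ?T k x w k + B k *v v)) \<partial>?g) \<partial>?W k) \<partial>?G)"
  proof (rule nn_integral_cong)
    fix x assume "x \<in> space ?G"
    then have [measurable]: "(\<lambda>w. ?T (Suc k) x w) \<in> ?W (Suc k) \<rightarrow>\<^sub>M path_space (Suc k)"
      using measurable_compose[OF measurable_Pair1' T[of "Suc k"], of x] by simp
    have "(\<integral>\<^sup>+w. f (?T (Suc k) x w) \<partial>?W (Suc k)) = (\<integral>\<^sup>+w. (\<integral>\<^sup>+v. f (?T (Suc k) x (w(k := v))) \<partial>?g) \<partial>?W k)"
      unfolding lessThan_Suc by (rule W.product_nn_integral_insert) (simp_all add: lessThan_Suc[symmetric])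
    moreover have "?T (Suc k) x (w(k := v)) = (?T k x w)(Suc k := A k *v ?T k x w k + B k *v v)" for w v
    proof -
      have "traj A B x (w(k := v)) i = traj A B x w i" if "i \<le> k" for i
        using that by (intro traj_cong) auto
      then show ?thesis by (auto simp: fun_eq_iff restrict_def)
    qed
    ultimately show "(\<integral>\<^sup>+w. f (?T (Suc k) x w) \<partial>?W (Suc k)) =
      (\<integral>\<^sup>+w. (\<integral>\<^sup>+v. f ((?T k x w)(Suc k := A k *v ?T k x w k + B k *v v)) \<partial>?g) \<partial>?W k)"
      by (simp only:)
  qed
  also have "\<dots> = (\<integral>\<^sup>+p. (\<integral>\<^sup>+w. f (p(Suc k := A k *v p k + B k *v w)) \<partial>?g) \<partial>traj_law A B \<Sigma>0 k)"
  proof (rule integ[symmetric])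
    have "(\<lambda>q. f (case q of (p, w) \<Rightarrow> p(Suc k := A k *v p k + B k *v w))) \<in> borel_measurable (path_space k \<Otimes>\<^sub>M ?g)"
      by measurable
    then have "case_prod (\<lambda>p w. f (p(Suc k := A k *v p k + B k *v w))) \<in> borel_measurable (path_space k \<Otimes>\<^sub>M ?g)"
      by (simp add: case_prod_beta')
    then show "(\<lambda>p. \<integral>\<^sup>+w. f (p(Suc k := A k *v p k + B k *v w)) \<partial>?g) \<in> borel_measurable (path_space k)"
      by (rule g.borel_measurable_nn_integral)
  qed
  finally show ?thesis .
qed

end

subsection \<open>Likelihood ratio of the closed loop\<close>

text \<open>Definiteness is carried through the induction together with the law, since
  \<open>gaussian\<close> has its meaning only for positive definite covariances; invertibility of
  \<open>A i\<close> preserves it.\<close>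

lemma distr_traj_law_state:
  fixes A :: "nat \<Rightarrow> real^'n^'n" and B :: "nat \<Rightarrow> real^'m^'n"
  assumes A: "\<And>i. i < N \<Longrightarrow> invertible (A i)" and \<Sigma>0: "pos_def (\<Sigma> 0)"
    and \<Sigma>: "\<And>i. i < N \<Longrightarrow> \<Sigma> (Suc i) = A i ** \<Sigma> i ** transpose (A i) + B i ** transpose (B i)"
    and k: "k \<le> N"
  shows "pos_def (\<Sigma> k) \<and> distr (traj_law A B (\<Sigma> 0) k) borel (\<lambda>p. p k) = gaussian 0 (\<Sigma> k)"
  using k
proof (induction k)
  case 0
  then show ?case using distr_traj_law_initial[OF \<Sigma>0, of A B 0] \<Sigma>0 by simp
next
  case (Suc k)
  then have k: "k < N" and IH: "pos_def (\<Sigma> k)" "distr (traj_law A B (\<Sigma> 0) k) borel (\<lambda>p. p k) = gaussian 0 (\<Sigma> k)"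
    by simp_all
  interpret g: prob_space "gaussian (0 :: real^'m) (mat 1)" by (rule prob_space_standard_gaussian)
  have pk: "(\<lambda>p. p l) \<in> traj_law A B (\<Sigma> 0) l \<rightarrow>\<^sub>M borel" for l
    by (subst measurable_cong_sets[OF sets_traj_law refl]) (rule measurable_path_component[OF order_refl])
  have "pos_def (A k ** \<Sigma> k ** transpose (A k))"
    using pos_def_congruence[OF IH(1) transpose_invertible[OF A[OF k]]] by simp
  then have "pos_def (\<Sigma> (Suc k))"
    unfolding \<Sigma>[OF k] by (intro pos_def_add_semidef pos_semidef_gram)
  moreover have "distr (traj_law A B (\<Sigma> 0) (Suc k)) borel (\<lambda>p. p (Suc k)) = gaussian 0 (\<Sigma> (Suc k))"
  proof (rule measure_eqI)
    fix X assume "X \<in> sets (distr (traj_law A B (\<Sigma> 0) (Suc k)) borel (\<lambda>p. p (Suc k)))"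
    then have X[measurable]: "X \<in> sets borel" by simp
    have "emeasure (distr (traj_law A B (\<Sigma> 0) (Suc k)) borel (\<lambda>p. p (Suc k))) X =
        (\<integral>\<^sup>+x. indicator X x \<partial>distr (traj_law A B (\<Sigma> 0) (Suc k)) borel (\<lambda>p. p (Suc k)))"
      by (rule nn_integral_indicator[symmetric]) simp
    also have "\<dots> = (\<integral>\<^sup>+p. indicator X (p (Suc k)) \<partial>traj_law A B (\<Sigma> 0) (Suc k))"
      by (rule nn_integral_distr[OF pk]) simp
    also have "\<dots> = (\<integral>\<^sup>+p. (\<integral>\<^sup>+w. indicator X (A k *v p k + B k *v w) \<partial>gaussian 0 (mat 1)) \<partial>traj_law A B (\<Sigma> 0) k)"
      by (subst nn_integral_traj_law_Suc[OF \<Sigma>0])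
        (simp_all add: measurable_compose[OF measurable_path_component[OF order_refl]])
    also have "\<dots> = (\<integral>\<^sup>+x. (\<integral>\<^sup>+w. indicator X (A k *v x + B k *v w) \<partial>gaussian 0 (mat 1))
        \<partial>distr (traj_law A B (\<Sigma> 0) k) borel (\<lambda>p. p k))"
      by (rule nn_integral_distr[OF pk, symmetric]) simp
    also have "\<dots> = (\<integral>\<^sup>+x. indicator X x \<partial>gaussian 0 (\<Sigma> (Suc k)))"
      unfolding IH(2) \<Sigma>[OF k]
      by (rule nn_integral_gaussian_linear_add[OF IH(1) A[OF k]]) measurable
    also have "\<dots> = emeasure (gaussian 0 (\<Sigma> (Suc k))) X" by (rule nn_integral_indicator) simp
    finally show "emeasure (distr (traj_law A B (\<Sigma> 0) (Suc k)) borel (\<lambda>p. p (Suc k))) X =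
      emeasure (gaussian 0 (\<Sigma> (Suc k))) X" .
  qed simp
  ultimately show ?case by simp
qed

text \<open>Separates the likelihood ratio from the choice of \<open>Q 0\<close>: it holds for any
  invertible symmetric solution of the recursion with positive definite \<open>W k\<close>.\<close>

locale riccati_feedback =
  fixes N :: nat and A Q F :: "nat \<Rightarrow> real^'n^'n" and B BF :: "nat \<Rightarrow> real^'m^'n" and W :: "nat \<Rightarrow> real^'m^'m"
  assumes A: "\<And>k. k < N \<Longrightarrow> invertible (A k)"
    and Q: "\<And>k. k \<le> N \<Longrightarrow> invertible (Q k)" "\<And>k. k \<le> N \<Longrightarrow> transpose (Q k) = Q k"
    and Q_Suc: "\<And>k. k < N \<Longrightarrow> Q (Suc k) = A k ** Q k ** transpose (A k) - B k ** transpose (B k)"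
    and W: "\<And>k. k < N \<Longrightarrow> pos_def (W k)"
      "\<And>k. k < N \<Longrightarrow> W k = mat 1 + transpose (B k) ** matrix_inv (Q (Suc k)) ** B k"
    and F: "\<And>k. k < N \<Longrightarrow> F k = A k - B k ** matrix_inv (W k) ** transpose (B k) ** matrix_inv (Q (Suc k)) ** A k"
    and BF: "\<And>k. k < N \<Longrightarrow> BF k = B k ** inv_sqrt (W k)"
begin

text \<open>The sum collects the normalisers of the tilted noises; the quadratic part is what
  telescoping over the intermediate states leaves.\<close>

definition likelihood_exponent :: "nat \<Rightarrow> (nat \<Rightarrow> real^'n) \<Rightarrow> real" where
  "likelihood_exponent k p = (\<Sum>i<k. ln (sqrt (det (W i)))) +
     (p 0 \<bullet> (matrix_inv (Q 0) *v p 0) - p k \<bullet> (matrix_inv (Q k) *v p k)) / 2"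

lemma measurable_likelihood_exponent[measurable]: "likelihood_exponent k \<in> borel_measurable (path_space k)"
proof -
  have [measurable]: "(\<lambda>p. p i) \<in> path_space k \<rightarrow>\<^sub>M borel" if "i \<le> k" for i
    using that by (rule measurable_path_component)
  show ?thesis unfolding likelihood_exponent_def[abs_def] by measurable
qed

text \<open>The closed-loop step is the open-loop step driven by noise of law N(m, W^-1), with m the
  feedback term. Passing to N(0, I) costs the factor of \<open>nn_integral_gaussian_shift\<close>,
  and the completed square identifies it with the increment of the exponent.\<close>

lemma likelihood_exponent_step:
  assumes k: "k < N" and p: "p \<in> space (path_space k)"
    and f[measurable]: "f \<in> borel_measurable (path_space (Suc k))"
  shows "ennreal (exp (likelihood_exponent k p)) *
      (\<integral>\<^sup>+w. f (p(Suc k := F k *v p k + BF k *v w)) \<partial>gaussian 0 (mat 1)) =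
    (\<integral>\<^sup>+w. ennreal (exp (likelihood_exponent (Suc k) (p(Suc k := A k *v p k + B k *v w)))) *
      f (p(Suc k := A k *v p k + B k *v w)) \<partial>gaussian 0 (mat 1))"
proof -
  define K where "K = matrix_inv (W k) ** transpose (B k) ** matrix_inv (Q (Suc k)) ** A k"
  define m where "m = - (K *v p k)"
  let ?f = "\<lambda>w. f (p(Suc k := A k *v p k + B k *v w))"
  have f'[measurable]: "?f \<in> borel_measurable borel"
    using measurable_compose[OF measurable_Pair1' measurable_compose[OF measurable_path_extend f], OF p, of borel "A k" "B k"]
    by simp
  \<comment> \<open>Feedback and noise shaping both act through \<open>B k\<close>, so they merge
    into one input.\<close>
  have "F k *v p k + BF k *v w = A k *v p k + B k *v (m + inv_sqrt (W k) *v w)" for w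
    by (simp add: F[OF k] BF[OF k] m_def K_def algebra_simps matrix_vector_mul_assoc matrix_mul_assoc
        linear_neg[OF matrix_vector_mul_linear])
  then have "ennreal (exp (likelihood_exponent k p)) *
      (\<integral>\<^sup>+w. f (p(Suc k := F k *v p k + BF k *v w)) \<partial>gaussian 0 (mat 1)) =
      ennreal (exp (likelihood_exponent k p)) *
      (\<integral>\<^sup>+w. ennreal (sqrt (det (W k)) * exp ((w \<bullet> w - (w - m) \<bullet> (W k *v (w - m))) / 2)) * ?f w
      \<partial>gaussian 0 (mat 1))"
    by (simp only: nn_integral_gaussian_shift[OF W(1)[OF k] f'])
  also have "\<dots> =
      (\<integral>\<^sup>+w. ennreal (exp (likelihood_exponent k p)) *
        (ennreal (sqrt (det (W k)) * exp ((w \<bullet> w - (w - m) \<bullet> (W k *v (w - m))) / 2)) * ?f w)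
      \<partial>gaussian 0 (mat 1))"
    by (rule nn_integral_cmult[symmetric]) measurable
  also have "\<dots> = (\<integral>\<^sup>+w. ennreal (exp (likelihood_exponent (Suc k) (p(Suc k := A k *v p k + B k *v w)))) * ?f w
      \<partial>gaussian 0 (mat 1))"
  proof (rule nn_integral_cong)
    fix w
    have det: "0 < sqrt (det (W k))" using det_pos_def[OF W(1)[OF k]] by simp
    define z where "z = A k *v p k + B k *v w"
    define v where "v = (w - m) \<bullet> (W k *v (w - m))"
    have "w + K *v p k = w - m" by (simp add: m_def)
    then have "w \<bullet> w - v - p k \<bullet> (matrix_inv (Q k) *v p k) = - (z \<bullet> (matrix_inv (Q (Suc k)) *v z))"
      using riccati_complete_square[OF A[OF k] _ _ _ Q_Suc[OF k] W[OF k] F[OF k], of w "p k"] Q k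
      by (simp add: K_def z_def v_def)
    then have "likelihood_exponent (Suc k) (p(Suc k := z)) =
        likelihood_exponent k p + (ln (sqrt (det (W k))) + (w \<bullet> w - v) / 2)"
      by (simp add: likelihood_exponent_def field_simps)
    then have "exp (likelihood_exponent (Suc k) (p(Suc k := z))) =
        exp (likelihood_exponent k p) * (sqrt (det (W k)) * exp ((w \<bullet> w - v) / 2))"
      using det by (simp add: exp_add)
    then show "ennreal (exp (likelihood_exponent k p)) *
        (ennreal (sqrt (det (W k)) * exp ((w \<bullet> w - (w - m) \<bullet> (W k *v (w - m))) / 2)) * ?f w) =
      ennreal (exp (likelihood_exponent (Suc k) (p(Suc k := A k *v p k + B k *v w)))) * ?f w"
      using det unfolding z_def v_def by (simp add: ennreal_mult mult.assoc)
  qed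
  finally show ?thesis .
qed

lemma feedback_law_density:
  assumes \<Sigma>0: "pos_def \<Sigma>0" and k: "k \<le> N"
  shows "traj_law F BF \<Sigma>0 k = density (traj_law A B \<Sigma>0 k) (\<lambda>p. ennreal (exp (likelihood_exponent k p)))"
  using k
proof (induction k)
  case 0
  have "traj_law F BF \<Sigma>0 0 = traj_law A B \<Sigma>0 0"
    unfolding traj_law_def by (rule distr_cong) (auto simp: restrict_def fun_eq_iff)
  then show ?case by (simp add: likelihood_exponent_def density_1)
next
  case (Suc k)
  then have k: "k < N"
    and IH: "traj_law F BF \<Sigma>0 k = density (traj_law A B \<Sigma>0 k) (\<lambda>p. ennreal (exp (likelihood_exponent k p)))"
    by simp_all
  interpret g: prob_space "gaussian (0 :: real^'m) (mat 1)" by (rule prob_space_standard_gaussian)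
  show ?case
  proof (rule measure_eqI)
    fix X assume "X \<in> sets (traj_law F BF \<Sigma>0 (Suc k))"
    then have X[measurable]: "X \<in> sets (path_space (Suc k))" by simp
    have upd[measurable]: "(\<lambda>(p, w). p(Suc k := F k *v p k + BF k *v w)) \<in>
        path_space k \<Otimes>\<^sub>M gaussian (0 :: real^'m) (mat 1) \<rightarrow>\<^sub>M path_space (Suc k)"
      by (rule measurable_path_extend) simp
    have "(\<lambda>q. indicator X (case q of (p, w) \<Rightarrow> p(Suc k := F k *v p k + BF k *v w)) :: ennreal)
        \<in> borel_measurable (path_space k \<Otimes>\<^sub>M gaussian (0 :: real^'m) (mat 1))"
      by measurable
    then have "case_prod (\<lambda>p w. indicator X (p(Suc k := F k *v p k + BF k *v w)) :: ennreal)
        \<in> borel_measurable (path_space k \<Otimes>\<^sub>M gaussian (0 :: real^'m) (mat 1))"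
      by (simp add: case_prod_beta')
    then have inner[measurable]: "(\<lambda>p. \<integral>\<^sup>+w. indicator X (p(Suc k := F k *v p k + BF k *v w)) \<partial>gaussian (0 :: real^'m) (mat 1))
        \<in> borel_measurable (path_space k)"
      by (rule g.borel_measurable_nn_integral)
    have "emeasure (traj_law F BF \<Sigma>0 (Suc k)) X = (\<integral>\<^sup>+p. indicator X p \<partial>traj_law F BF \<Sigma>0 (Suc k))"
      by (rule nn_integral_indicator[symmetric]) simp
    also have "\<dots> = (\<integral>\<^sup>+p. (\<integral>\<^sup>+w. indicator X (p(Suc k := F k *v p k + BF k *v w)) \<partial>gaussian 0 (mat 1))
        \<partial>traj_law F BF \<Sigma>0 k)"
      by (rule nn_integral_traj_law_Suc[OF \<Sigma>0]) measurable
    also have "\<dots> = (\<integral>\<^sup>+p. ennreal (exp (likelihood_exponent k p)) *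
        (\<integral>\<^sup>+w. indicator X (p(Suc k := F k *v p k + BF k *v w)) \<partial>gaussian 0 (mat 1)) \<partial>traj_law A B \<Sigma>0 k)"
      unfolding IH by (rule nn_integral_density) measurable
    also have "\<dots> = (\<integral>\<^sup>+p. (\<integral>\<^sup>+w. ennreal (exp (likelihood_exponent (Suc k) (p(Suc k := A k *v p k + B k *v w)))) *
        indicator X (p(Suc k := A k *v p k + B k *v w)) \<partial>gaussian 0 (mat 1)) \<partial>traj_law A B \<Sigma>0 k)"
      by (intro nn_integral_cong likelihood_exponent_step[OF k]) simp_all
    also have "\<dots> = (\<integral>\<^sup>+p. ennreal (exp (likelihood_exponent (Suc k) p)) * indicator X p \<partial>traj_law A B \<Sigma>0 (Suc k))"
      by (rule nn_integral_traj_law_Suc[OF \<Sigma>0, symmetric]) measurable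
    also have "\<dots> = emeasure (density (traj_law A B \<Sigma>0 (Suc k)) (\<lambda>p. ennreal (exp (likelihood_exponent (Suc k) p)))) X"
      by (rule emeasure_density[symmetric]) simp_all
    finally show "emeasure (traj_law F BF \<Sigma>0 (Suc k)) X =
      emeasure (density (traj_law A B \<Sigma>0 (Suc k)) (\<lambda>p. ennreal (exp (likelihood_exponent (Suc k) p)))) X" .
  qed simp
qed

text \<open>\<open>riccati_closed_loop\<close> exhibits \<open>F k\<close> as a product of
  invertible matrices, which the covariance recursion requires of the drift.\<close>

lemma feedback_invertible: "k < N \<Longrightarrow> invertible (F k)"
  using riccati_closed_loop[OF A _ _ _ Q_Suc W F, of k] Q[of k] Q[of "Suc k"] A[of k]
  by (simp add: invertible_mult invertible_matrix_inv transpose_invertible)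

text \<open>Along the closed loop the covariance keeps the form \<open>Q Y Q + Q\<close>, where
  \<open>Y\<close> is transported by the uncontrolled dynamics alone.\<close>

lemma distr_feedback_law_terminal:
  assumes \<Sigma>0: "pos_def \<Sigma>0"
  defines "X \<equiv> matrix_inv (Q 0) ** \<Sigma>0 ** matrix_inv (Q 0) - matrix_inv (Q 0)"
    and "\<Psi> \<equiv> transition A 0 N"
  shows "distr (traj_law F BF \<Sigma>0 N) borel (\<lambda>p. p N) =
    gaussian 0 (Q N ** (transpose \<Psi> ** X ** \<Psi>) ** Q N + Q N)"
proof -
  define Y where "Y k = transpose (transition A 0 k) ** X ** transition A 0 k" for k
  define \<Sigma> where "\<Sigma> k = Q k ** Y k ** Q k + Q k" for k
  \<comment> \<open>X was obtained by solving \<Sigma>0 = Q X Q + Q at time 0.\<close>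
  have "\<Sigma> 0 = \<Sigma>0"
    using Q(1)[of 0] by (simp add: \<Sigma>_def Y_def X_def transition_self matrix_ring_simps
        matrix_inv_mult matrix_inv_cancel)
  moreover have "\<Sigma> (Suc k) = F k ** \<Sigma> k ** transpose (F k) + BF k ** transpose (BF k)" if k: "k < N" for k
  proof -
    have BB: "BF k ** transpose (BF k) = B k ** matrix_inv (W k) ** transpose (B k)"
      unfolding BF[OF k] matrix_transpose_mul pos_defD(1)[OF inv_sqrt_pos_def(1)[OF W(1)[OF k]]]
      by (metis inv_sqrt_pos_def(2)[OF W(1)[OF k]] matrix_mul_assoc)
    have Y: "Y (Suc k) = matrix_inv (transpose (A k)) ** Y k ** matrix_inv (A k)"
      by (simp add: Y_def transition_0_Suc matrix_transpose_mul matrix_mul_assoc matrix_inv_transpose[OF A[OF k]])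
    show ?thesis
      unfolding \<Sigma>_def BB Y
      by (rule riccati_covariance[OF A[OF k] _ _ _ Q_Suc[OF k] W[OF k] F[OF k], symmetric]) (use Q k in auto)
  qed
  ultimately show ?thesis
    using distr_traj_law_state[of N F \<Sigma> BF N] feedback_invertible \<Sigma>0 by (simp add: \<Sigma>_def Y_def \<Psi>_def)
qed

end

section \<open>Relative entropy and the optimality criterion\<close>

text \<open>Dividing dP/dR by dS/dR = exp \<phi> gives dP/dS, so the two divergences differ by the
  integral of \<phi>, and Gibbs' inequality with its equality case applies to P and S.\<close>

lemma KL_exp_density:
  fixes R P :: "'a measure" and \<phi> :: "'a \<Rightarrow> real"
  defines "S \<equiv> density R (\<lambda>x. ennreal (exp (\<phi> x)))"
  assumes R: "prob_space R" and S: "prob_space S" and P: "prob_space P" "sets P = sets R"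
    and [measurable]: "\<phi> \<in> borel_measurable R" and int: "integrable P \<phi>"
  shows "ereal (\<integral>x. \<phi> x \<partial>P) \<le> KL P R"
    and "KL P R = ereal (\<integral>x. \<phi> x \<partial>P) \<longleftrightarrow> P = S"
proof -
  interpret R: prob_space R by (rule R)
  interpret S: prob_space S by (rule S)
  interpret P: prob_space P by (rule P)
  interpret S: information_space S "exp 1 :: real" by standard simp
  note P(2)[measurable_cong]
  have sets_S[simp, measurable_cong]: "sets S = sets R" by (simp add: S_def)
  have log: "log (exp 1) t = ln t" for t :: real by (simp add: log_def)
  \<comment> \<open>Serves the direction from P = S to equality: the value is read off from the
    known density exp \<phi>.\<close>
  have self: "KL S R = ereal (\<integral>x. \<phi> x \<partial>S)" if int_S: "integrable S \<phi>"
  proof -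
    have "AE x in R. ennreal (exp (\<phi> x)) = RN_deriv R S x"
      by (rule R.RN_deriv_unique) (simp_all add: S_def)
    then have "AE x in R. entropy_density (exp 1) R S x = \<phi> x"
      by eventually_elim (metis comp_def enn2real_ennreal entropy_density_def exp_ge_zero ln_exp log)
    then have "AE x in R. 0 < ennreal (exp (\<phi> x)) \<longrightarrow> entropy_density (exp 1) R S x = \<phi> x"
      by eventually_elim simp
    then have AE: "AE x in S. entropy_density (exp 1) R S x = \<phi> x"
      by (subst (1) S_def) (simp add: AE_density)
    have ent: "entropy_density (exp 1) R S \<in> borel_measurable S"
      using measurable_entropy_density[of "exp 1" R S] by simp
    have "absolutely_continuous R S" unfolding S_def by (rule absolutely_continuousI_density) measurable
    moreover have "integrable S (entropy_density (exp 1) R S)"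
      using integrable_cong_AE[OF ent _ AE] int_S by simp
    moreover have "KL_divergence (exp 1) R S = (\<integral>x. \<phi> x \<partial>S)"
      unfolding KL_divergence_def by (rule integral_cong_AE[OF ent _ AE]) simp
    ultimately show ?thesis by (simp add: KL_def)
  qed
  \<comment> \<open>Here d is the divergence of P from S; only its sign and its zero case are used
    afterwards.\<close>
  have chain: "\<exists>d. KL P R = ereal (d + (\<integral>x. \<phi> x \<partial>P)) \<and> 0 \<le> d \<and> (d = 0 \<longrightarrow> P = S)" if fin: "KL P R \<noteq> \<infinity>"
  proof -
    from fin have ac: "absolutely_continuous R P" and int_ent: "integrable P (entropy_density (exp 1) R P)"
      and KL: "KL P R = ereal (KL_divergence (exp 1) R P)"
      by (auto simp: KL_def split: if_splits)
    obtain D where D[measurable]: "D \<in> borel_measurable R" and RN: "AE x in R. RN_deriv R P x = ennreal (D x)"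
      and D0: "\<And>x. 0 \<le> D x"
      using R.real_RN_deriv[OF P.finite_measure_axioms ac P(2)] by metis
    have "P = density R (RN_deriv R P)" by (rule R.density_RN_deriv[OF ac P(2), symmetric])
    also have "\<dots> = density R D" using RN by (intro density_cong) auto
    finally have PD: "P = density R D" .
    define E where "E x = D x / exp (\<phi> x)" for x
    have E[measurable]: "E \<in> borel_measurable S" and E0: "0 \<le> E x" for x
      unfolding E_def[abs_def] using D0 by (measurable, simp)
    have PE: "P = density S E"
      unfolding PD S_def E_def using D0 by (intro density_density_divide[symmetric]) auto
    \<comment> \<open>The quotient rule for \<open>ln\<close> needs D > 0, and the zero set of D is
      null for P itself.\<close>
    have AE_D: "AE x in P. 0 < D x"
      unfolding PD using D0 by (subst AE_density) (auto simp: less_le)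
    have AE_ent: "AE x in P. entropy_density (exp 1) R P x = ln (D x)"
      using absolutely_continuous_AE[OF P(2) ac RN]
      by eventually_elim (simp add: entropy_density_def log D0)
    have ent_m: "entropy_density (exp 1) R P \<in> borel_measurable P"
      using measurable_entropy_density[of "exp 1" R P] by simp
    have int_D: "integrable P (\<lambda>x. ln (D x))"
      using integrable_cong_AE[OF ent_m _ AE_ent] int_ent by simp
    have KL_D: "KL_divergence (exp 1) R P = (\<integral>x. ln (D x) \<partial>P)"
      unfolding KL_divergence_def by (rule integral_cong_AE[OF ent_m _ AE_ent]) simp
    have AE_E: "AE x in P. ln (E x) = ln (D x) - \<phi> x"
      using AE_D by eventually_elim (simp add: E_def ln_div)
    have int_E: "integrable P (\<lambda>x. ln (E x))"
      using integrable_cong_AE[OF _ _ AE_E] int_D int by simp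
    have "(\<integral>x. ln (E x) \<partial>P) = (\<integral>x. ln (D x) - \<phi> x \<partial>P)"
      by (rule integral_cong_AE[OF _ _ AE_E]) simp_all
    also have "\<dots> = (\<integral>x. ln (D x) \<partial>P) - (\<integral>x. \<phi> x \<partial>P)" by (rule Bochner_Integration.integral_diff[OF int_D int])
    finally have eq: "KL_divergence (exp 1) R P = (\<integral>x. ln (E x) \<partial>P) + (\<integral>x. \<phi> x \<partial>P)"
      by (simp add: KL_D)
    have int_SE: "integrable S (\<lambda>x. E x * log (exp 1) (E x))"
      using int_E unfolding PE by (subst (asm) integrable_density) (simp_all add: E0 log)
    have prob: "prob_space (density S E)" using P(1) PE by simp
    have KL_S: "KL_divergence (exp 1) S (density S E) = (\<integral>x. ln (E x) \<partial>P)"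
      unfolding PE by (subst S.KL_density) (simp_all add: E0 log integral_density)
    show ?thesis
      using S.KL_nonneg[OF prob E _ int_SE] S.KL_eq_0_iff_eq[OF prob E _ int_SE] E0 KL eq KL_S PE
      by (intro exI[of _ "\<integral>x. ln (E x) \<partial>P"]) auto
  qed
  show "ereal (\<integral>x. \<phi> x \<partial>P) \<le> KL P R"
    using chain by (cases "KL P R = \<infinity>") auto
  show "KL P R = ereal (\<integral>x. \<phi> x \<partial>P) \<longleftrightarrow> P = S"
    using chain self int by (cases "KL P R = \<infinity>") auto
qed

lemma bridge_optimal_unique:
  fixes R :: "(nat \<Rightarrow> real^'n) measure"
  defines "S \<phi> \<equiv> density R (\<lambda>x. ennreal (exp (\<phi> x)))"
  assumes R: "prob_space R" "sets R = sets (path_space N :: (nat \<Rightarrow> real^'n) measure)"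
    and \<phi>: "\<phi> \<in> borel_measurable R"
    and feas: "bridge_feasible N \<Sigma>0 \<Sigma>N (S \<phi>)"
    and int: "\<And>P. bridge_feasible N \<Sigma>0 \<Sigma>N P \<Longrightarrow> integrable P \<phi>"
      "\<And>P. bridge_feasible N \<Sigma>0 \<Sigma>N P \<Longrightarrow> (\<integral>x. \<phi> x \<partial>P) = c"
  shows "bridge_optimal N \<Sigma>0 \<Sigma>N R (S \<phi>)"
    and "bridge_optimal N \<Sigma>0 \<Sigma>N R P \<Longrightarrow> P = S \<phi>"
proof -
  have ge: "ereal c \<le> KL P R" and eq: "KL P R = ereal c \<longleftrightarrow> P = S \<phi>"
    if "bridge_feasible N \<Sigma>0 \<Sigma>N P" for P
    using KL_exp_density[OF R(1), of \<phi> P] feas that int[OF that] R(2) \<phi>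
    by (auto simp: bridge_feasible_def S_def)
  show opt: "bridge_optimal N \<Sigma>0 \<Sigma>N R (S \<phi>)"
    using ge eq[OF feas] feas by (simp add: bridge_optimal_def)
  assume P: "bridge_optimal N \<Sigma>0 \<Sigma>N R P"
  then have "KL P R = ereal c"
    using ge[of P] eq[OF feas] feas by (auto simp: bridge_optimal_def intro!: antisym)
  then show "P = S \<phi>" using eq P by (simp add: bridge_optimal_def)
qed

theorem theorem3:
  fixes N :: nat
    and A AQ :: "nat \<Rightarrow> real^'n^'n"
    and B BQ :: "nat \<Rightarrow> real^'m^'n"
    and \<Sigma>0 \<Sigma>N S0 SN :: "real^'n^'n"
    and Q :: "nat \<Rightarrow> real^'n^'n"
    and M :: "'a measure" and w :: "nat \<Rightarrow> 'a \<Rightarrow> real^'m" and x :: "nat \<Rightarrow> 'a \<Rightarrow> real^'n"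
    and M' :: "'b measure" and w' :: "nat \<Rightarrow> 'b \<Rightarrow> real^'m" and x' :: "nat \<Rightarrow> 'b \<Rightarrow> real^'n"
  assumes N: "N > 0"
    and \<Sigma>0: "pos_def \<Sigma>0" and \<Sigma>N: "pos_def \<Sigma>N"
    and A_inv: "\<forall>k<N. invertible (A k)"
    and gramians: "\<exists>kr\<in>{1..N}. (\<forall>k\<in>{kr..N}. invertible (reach_gramian A B k 0)) \<and>
                               (\<forall>k\<in>{0..<kr}. invertible (reach_gramian A B N k))"
    and S0: "S0 = inv_sqrt (contr_gramian A B N 0) ** \<Sigma>0 ** inv_sqrt (contr_gramian A B N 0)"
    and SN: "SN = inv_sqrt (contr_gramian A B N 0) ** transition A 0 N ** \<Sigma>N
                    ** transpose (transition A 0 N) ** inv_sqrt (contr_gramian A B N 0)"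
    and F_inv: "invertible (Fmat S0 SN)"
    and B_inv: "invertible (Bmat S0 SN)"
    and Q_0: "Q 0 = psd_sqrt (contr_gramian A B N 0) ** psd_sqrt S0 ** matrix_inv (Fmat S0 SN)
                      ** psd_sqrt S0 ** psd_sqrt (contr_gramian A B N 0)"
    and Q_Suc: "\<forall>k<N. Q (k+1) = A k ** Q k ** transpose (A k) - B k ** transpose (B k)"
    and AQ: "\<forall>k<N. AQ k = A k - B k
               ** matrix_inv (mat 1 + transpose (B k) ** matrix_inv (Q (k+1)) ** B k)
               ** transpose (B k) ** matrix_inv (Q (k+1)) ** A k"
    and BQ: "\<forall>k<N. BQ k = B k
               ** inv_sqrt (mat 1 + transpose (B k) ** matrix_inv (Q (k+1)) ** B k)"
    and optimal_process: "linear_gaussian_process M N AQ BQ \<Sigma>0 w x"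
    and prior_process: "linear_gaussian_process M' N A B \<Sigma>0 w' x'"
  shows "bridge_optimal N \<Sigma>0 \<Sigma>N (path_law M' N x') (path_law M N x) \<and>
         (\<forall>P. bridge_optimal N \<Sigma>0 \<Sigma>N (path_law M' N x') P \<longrightarrow> P = path_law M N x)"
proof -
  define \<Psi> where "\<Psi> k = transition A 0 k" for k
  define g where "g k = contr_gramian A B k 0" for k
  define W where "W k = mat 1 + transpose (B k) ** matrix_inv (Q (Suc k)) ** B k" for k
  \<comment> \<open>The terminal covariance carried back to time 0; with it SN has the same shape as
    S0.\<close>
  define Y where "Y = \<Psi> N ** \<Sigma>N ** transpose (\<Psi> N)"
  have \<Psi>inv: "invertible (\<Psi> k)" if "k \<le> N" for k
    unfolding \<Psi>_def using A_inv that by (intro invertible_transition_0) simp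
  have "invertible (reach_gramian A B N 0)" using gramians by auto
  then have G: "pos_def (g N)" unfolding g_def by (intro pos_def_contr_gramian A_inv)
  have Y: "pos_def Y"
    using pos_def_congruence[OF \<Sigma>N transpose_invertible[OF \<Psi>inv[OF order_refl]]] by (simp add: Y_def)
  have SN_Y: "SN = inv_sqrt (g N) ** Y ** inv_sqrt (g N)"
    by (simp add: SN Y_def g_def \<Psi>_def matrix_mul_assoc)
  note init = bridge_initial_matrix[OF G \<Sigma>0 Y S0[folded g_def] SN_Y F_inv Q_0[folded g_def]]
  have g_psd: "pos_semidef (g k)" for k unfolding g_def by (rule pos_semidef_contr_gramian)
  have g_mono: "pos_semidef (g N - g k)" if "k \<le> N" for k
    unfolding g_def by (rule contr_gramian_mono[OF that])
  have g_Suc: "g (Suc k) = g k + \<Psi> (Suc k) ** B k ** transpose (\<Psi> (Suc k) ** B k)" for k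
    by (simp add: g_def \<Psi>_def contr_gramian_Suc)
  \<comment> \<open>Carried back to time 0, the recursion is solved in closed form: each step
    subtracts one Gramian increment.\<close>
  have q: "\<Psi> k ** Q k ** transpose (\<Psi> k) = Q 0 - g k" if "k \<le> N" for k
    using that
  proof (induction k)
    case 0
    then show ?case by (simp add: \<Psi>_def transition_self g_def contr_gramian_def)
  next
    case (Suc k)
    then have Ak: "invertible (A k)" and k: "k < N" using A_inv by auto
    note Akt = transpose_invertible[OF Ak]
    have "\<Psi> (Suc k) ** Q (Suc k) ** transpose (\<Psi> (Suc k)) =
      \<Psi> k ** Q k ** transpose (\<Psi> k) - \<Psi> (Suc k) ** B k ** transpose (\<Psi> (Suc k) ** B k)"
      using Q_Suc k
      by (simp add: \<Psi>_def transition_0_Suc matrix_ring_simps transpose_simps matrix_inv_cancel[OF Ak]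
          matrix_inv_transpose[OF Ak, symmetric] matrix_inv_cancel[OF Akt])
    then show ?case using Suc by (simp add: g_Suc)
  qed
  have Q_q: "matrix_inv (Q k) = transpose (\<Psi> k) ** matrix_inv (Q 0 - g k) ** \<Psi> k" "invertible (Q k)"
    if k: "k \<le> N" for k
  proof -
    note P = \<Psi>inv[OF k]
    note Pt = transpose_invertible[OF P]
    have qi: "invertible (Q 0 - g k)"
      by (rule riccati_no_escape(1)[OF G init(1-3) g_psd g_mono[OF k]])
    have Qk: "Q k = matrix_inv (\<Psi> k) ** (Q 0 - g k) ** matrix_inv (transpose (\<Psi> k))"
      unfolding q[OF k, symmetric]
      by (simp add: matrix_mul_assoc[symmetric] matrix_inv_cancel matrix_inv_mult P Pt)
    show "invertible (Q k)"
      unfolding Qk by (intro invertible_mult invertible_matrix_inv P Pt qi)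
    show "matrix_inv (Q k) = transpose (\<Psi> k) ** matrix_inv (Q 0 - g k) ** \<Psi> k"
      unfolding Qk
      by (simp add: matrix_inv_matrix_mult invertible_mult invertible_matrix_inv matrix_inv_matrix_inv
          P Pt qi matrix_mul_assoc)
  qed
  have Q_sym: "transpose (Q k) = Q k" if "k \<le> N" for k
    using that
    by (induction k) (use init(2) Q_Suc in \<open>simp_all add: transpose_simps matrix_mul_assoc\<close>)
  have W_pos: "pos_def (W k)" if k: "k < N" for k
  proof -
    \<comment> \<open>With this b the matrix in \<open>riccati_no_escape\<close> is
      \<open>W k\<close> itself, because carrying back changes \<open>B k\<close> and
      \<open>Q (Suc k)\<close> in compensating ways.\<close>
    let ?b = "\<Psi> (Suc k) ** B k"
    have "pos_semidef (g N - (g k + ?b ** transpose ?b))"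
      using g_mono[of "Suc k"] k by (simp add: g_Suc)
    from riccati_no_escape(2)[OF G init(1-3) g_psd this]
    have "pos_def (mat 1 + transpose ?b ** matrix_inv (Q 0 - g (Suc k)) ** ?b)"
      by (simp add: g_Suc)
    then show ?thesis
      using Q_q(1)[of "Suc k"] k by (simp add: W_def matrix_transpose_mul matrix_mul_assoc)
  qed
  interpret riccati_feedback N A Q AQ B BQ W
    by unfold_locales
      (use A_inv Q_q(2) Q_sym Q_Suc W_pos AQ BQ in \<open>auto simp: W_def\<close>)
  define R where "R = traj_law A B \<Sigma>0 N"
  define \<phi> where "\<phi> = likelihood_exponent N"
  define S where "S = density R (\<lambda>p. ennreal (exp (\<phi> p)))"
  have prior: "path_law M' N x' = R"
    unfolding R_def by (rule path_law_eq_traj_law[OF prior_process N])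
  have optimal: "path_law M N x = S"
    unfolding S_def R_def \<phi>_def path_law_eq_traj_law[OF optimal_process N]
    by (rule feedback_law_density[OF \<Sigma>0 order_refl])
  have S_traj: "S = traj_law AQ BQ \<Sigma>0 N"
    using optimal path_law_eq_traj_law[OF optimal_process N] by simp
  \<comment> \<open>Conjugated by \<open>\<Psi> N\<close>, this is the last conclusion of
    \<open>bridge_initial_matrix\<close>; invertibility of \<open>\<Psi> N\<close> undoes the
    conjugation.\<close>
  have "Q N ** (transpose (\<Psi> N) ** X ** \<Psi> N) ** Q N + Q N = \<Sigma>N"
    if X: "X = matrix_inv (Q 0) ** \<Sigma>0 ** matrix_inv (Q 0) - matrix_inv (Q 0)" for X
  proof -
    note P = \<Psi>inv[OF order_refl]
    note Pt = transpose_invertible[OF P]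
    let ?Z = "Q N ** (transpose (\<Psi> N) ** X ** \<Psi> N) ** Q N + Q N"
    have "\<Psi> N ** ?Z ** transpose (\<Psi> N) = (Q 0 - g N) ** X ** (Q 0 - g N) + (Q 0 - g N)"
      unfolding q[OF order_refl, symmetric]
      by (simp add: matrix_mul_assoc matrix_add_ldistrib matrix_add_rdistrib')
    also have "\<dots> = \<Psi> N ** \<Sigma>N ** transpose (\<Psi> N)"
      using init(4) by (simp add: X Y_def)
    finally have "matrix_inv (\<Psi> N) ** (\<Psi> N ** ?Z ** transpose (\<Psi> N)) ** matrix_inv (transpose (\<Psi> N)) =
      matrix_inv (\<Psi> N) ** (\<Psi> N ** \<Sigma>N ** transpose (\<Psi> N)) ** matrix_inv (transpose (\<Psi> N))"
      by (simp only:)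
    then show ?thesis
      by (simp only: matrix_mul_assoc[symmetric] matrix_inv_cancel[OF P] matrix_inv_mult[OF Pt] matrix_mul_rid)
  qed
  then have terminal: "distr S borel (\<lambda>p. p N) = gaussian 0 \<Sigma>N"
    using distr_feedback_law_terminal[OF \<Sigma>0] unfolding S_traj \<Psi>_def by simp
  have feas: "bridge_feasible N \<Sigma>0 \<Sigma>N S"
    unfolding bridge_feasible_def
    using prob_space_traj_law[OF \<Sigma>0, of AQ BQ N] distr_traj_law_initial[OF \<Sigma>0, of AQ BQ N] terminal
    by (simp add: S_traj)
  define c where "c = (\<Sum>i<N. ln (sqrt (det (W i)))) +
    ((\<integral>x. x \<bullet> (matrix_inv (Q 0) *v x) \<partial>gaussian 0 \<Sigma>0) - (\<integral>x. x \<bullet> (matrix_inv (Q N) *v x) \<partial>gaussian 0 \<Sigma>N)) / 2"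
  have int: "integrable P \<phi> \<and> (\<integral>p. \<phi> p \<partial>P) = c" if P: "bridge_feasible N \<Sigma>0 \<Sigma>N P" for P
  proof -
    have sets: "sets P = sets (path_space N)" and P0: "distr P borel (\<lambda>p. p 0) = gaussian 0 \<Sigma>0"
      and PN: "distr P borel (\<lambda>p. p N) = gaussian 0 \<Sigma>N" and "prob_space P"
      using P by (simp_all add: bridge_feasible_def)
    interpret P: prob_space P by fact
    have m: "(\<lambda>p. p i) \<in> P \<rightarrow>\<^sub>M borel" if "i \<le> N" for i
      unfolding measurable_cong_sets[OF sets refl] using that by (rule measurable_path_component)
    have quad: "(\<lambda>y. y \<bullet> (U *v y)) \<in> borel_measurable borel" for U :: "real^'n^'n"
      by measurable
    \<comment> \<open>The endpoint forms are integrable separately under the two marginals, so the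
      integral splits without any knowledge of the joint law.\<close>
    have i: "integrable P (\<lambda>p. p 0 \<bullet> (U *v p 0))" "integrable P (\<lambda>p. p N \<bullet> (U *v p N))" for U :: "real^'n^'n"
      using integrable_gaussian_quadratic[OF \<Sigma>0, of U] integrable_gaussian_quadratic[OF \<Sigma>N, of U]
        integrable_distr_eq[OF m[of 0] quad, of U] integrable_distr_eq[OF m[of N] quad, of U]
      by (simp_all add: P0 PN)
    have e: "(\<integral>p. p 0 \<bullet> (U *v p 0) \<partial>P) = (\<integral>y. y \<bullet> (U *v y) \<partial>gaussian 0 \<Sigma>0)"
      "(\<integral>p. p N \<bullet> (U *v p N) \<partial>P) = (\<integral>y. y \<bullet> (U *v y) \<partial>gaussian 0 \<Sigma>N)" for U :: "real^'n^'n"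
      using integral_distr[OF m[of 0] quad, of U] integral_distr[OF m[of N] quad, of U]
      by (simp_all add: P0 PN)
    show ?thesis
      unfolding \<phi>_def likelihood_exponent_def[abs_def] c_def
      using i by (simp add: e P.prob_space)
  qed
  have "prob_space R" "sets R = sets (path_space N)" "\<phi> \<in> borel_measurable R"
    unfolding R_def \<phi>_def using prob_space_traj_law[OF \<Sigma>0] by simp_all
  note main = bridge_optimal_unique[OF this feas[unfolded S_def], of c, folded S_def]
  show ?thesis
    unfolding prior optimal using main int by blast
qed

end
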